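(* Let $n\geq 1$ be an integer, let $a<b$ be real numbers, let $N,N'\subseteq\{0,1,\dots,n\}$, and let real numbers $u_i$ ($i\in N$) and $w_j$ ($j\in N'$) be given. Put $$\mathcal{N}_{N,N'}=\{u\in W^{n,2}(a,b) : u^{(i)}(a)=u_i \text{ for all } i\in N,\ u^{(j)}(b)=w_j \text{ for all } j\in N'\}.$$ Let $f=f(x_1,\dots,x_{n+2})$ be a real-valued function defined on $[a,b]\times\mathbb{R}^{n+1}$ with continuous second partial derivatives with respect to all its variables. Let $h\in L_2(a,b)$ and $c_1\geq 0$ be such that for almost all $x_1\in[a,b]$ and for all $(x_2,\dots,x_{n+2})\in\mathbb{R}^{n+1}$, $$|f(x_1,x_2,\dots,x_{n+2})|\leq h(x_1)+c_1\,(x_2^2+\dots+x_{n+2}^2),$$ $$\left|\frac{\partial f}{\partial x_i}(x_1,x_2,\dots,x_{n+2})\right|\leq h(x_1)+c_1\,(|x_2|+\dots+|x_{n+2}|)\quad\text{for } i\in\{2,\dots,n+2\}.$$ Define the functional $F$ on $\mathcal{N}_{N,N'}$ by $$F(u)=\int_a^b f(t,u(t),u'(t),\dots,u^{(n)}(t))\,dt .$$ Let $u_0\in\mathcal{N}_{N,N'}$ be a local extremum of $F$ with respect to $\mathcal{N}_{N,N'}$. For $t\in[a,b]$ and $s\in\mathbb{R}$ set $$\psi(t,s)=\frac{\partial f}{\partial x_{n+2}}\bigl(t,u_0(t),u_0'(t),\dots,u_0^{(n-1)}(t),s\bigr).$$ Assume that $\frac{\partial\psi}{\partial s}>0$ on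 $[a,b]\times\mathbb{R}$ and that for every fixed $t\in[a,b]$ the function $s\mapsto\psi(t,s)$ maps $\mathbb{R}$ onto $\mathbb{R}$. Then $u_0\in C^{n+1}[a,b]$.
   Context: $W^{n,2}(a,b)$ is the Sobolev space of real functions on $(a,b)$ whose weak derivatives up to order $n$ belong to $L^2(a,b)$, with norm $\|u\|_{W^{n,2}(a,b)}=\sum_{i=0}^n\|u^{(i)}\|_{2}$. For $u\in W^{n,2}(a,b)$ and $i\leq n-1$, $u^{(i)}$ is identified with its representative that is continuous on $[a,b]$, which gives meaning to its pointwise values. An endpoint condition on $u^{(n)}$ (present only when $n\in N$ or $n\in N'$) is understood to mean that $u^{(n)}$ agrees almost everywhere with a function on $[a,b]$ that is continuous at that endpoint and takes the prescribed value there. That $u_0\in\mathcal{N}_{N,N'}$ is a local extremum of $F$ with respect to $\mathcal{N}_{N,N'}$ means that there is $\varepsilon>0$ such that either $F(u)\geq F(u_0)$ for all $u\in\mathcal{N}_{N,N'}$ with $\|u-u_0\|_{W^{n,2}(a,b)}<\varepsilon$, or $F(u)\leq F(u_0)$ for all such $u$. The conclusion $u_0\in C^{n+1}[a,b]$ means that (the continuous representative of) $u_0$ is $n+1$ times continuously differentiable on $[a,b]$. *)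

theory Defs
  imports "HOL-Analysis.Analysis"
begin

section \<open>The Sobolev space of order n on an interval\<close>

text \<open>Elements of Lebesgue and Sobolev spaces are represented by functions on the real line; only
  their values almost everywhere on the open interval matter.\<close>

definition L2 :: "real \<Rightarrow> real \<Rightarrow> (real \<Rightarrow> real) set" where
  "L2 a b = {u. u \<in> borel_measurable (lebesgue_on {a<..<b}) \<and>
                integrable (lebesgue_on {a<..<b}) (\<lambda>x. (u x)\<^sup>2)}"

definition L2_norm :: "real \<Rightarrow> real \<Rightarrow> (real \<Rightarrow> real) \<Rightarrow> real" where
  "L2_norm a b u = sqrt (LINT x|lebesgue_on {a<..<b}. (u x)\<^sup>2)"

definition test_fun :: "real \<Rightarrow> real \<Rightarrow> (real \<Rightarrow> real) \<Rightarrow> bool" where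
  "test_fun a b \<phi> \<longleftrightarrow>
     (\<forall>k x. (deriv ^^ k) \<phi> differentiable (at x)) \<and>
     (\<exists>K. compact K \<and> K \<subseteq> {a<..<b} \<and> (\<forall>x. x \<notin> K \<longrightarrow> \<phi> x = 0))"

definition has_L2_weak_deriv ::
    "real \<Rightarrow> real \<Rightarrow> nat \<Rightarrow> (real \<Rightarrow> real) \<Rightarrow> (real \<Rightarrow> real) \<Rightarrow> bool" where
  "has_L2_weak_deriv a b i u v \<longleftrightarrow>
     u \<in> L2 a b \<and> v \<in> L2 a b \<and>
     (\<forall>\<phi>. test_fun a b \<phi> \<longrightarrow>
        (LINT x|lebesgue_on {a<..<b}. u x * (deriv ^^ i) \<phi> x) =
        (-1) ^ i * (LINT x|lebesgue_on {a<..<b}. v x * \<phi> x))"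

definition sobolev :: "nat \<Rightarrow> real \<Rightarrow> real \<Rightarrow> (real \<Rightarrow> real) set" where
  "sobolev n a b = {u. \<forall>i\<le>n. \<exists>v. has_L2_weak_deriv a b i u v}"

text \<open>The weak derivative is unique only up to null sets, and so is the choice made here.\<close>

definition weak_deriv :: "real \<Rightarrow> real \<Rightarrow> nat \<Rightarrow> (real \<Rightarrow> real) \<Rightarrow> real \<Rightarrow> real" where
  "weak_deriv a b i u = (SOME v. has_L2_weak_deriv a b i u v)"

definition sobolev_norm :: "nat \<Rightarrow> real \<Rightarrow> real \<Rightarrow> (real \<Rightarrow> real) \<Rightarrow> real" where
  "sobolev_norm n a b u = (\<Sum>i=0..n. L2_norm a b (weak_deriv a b i u))"

text \<open>The representative continuous on the closed interval, if there is one; for \<open>a < b\<close> its values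
  on \<open>{a..b}\<close> are then uniquely determined.\<close>

definition cont_rep :: "real \<Rightarrow> real \<Rightarrow> (real \<Rightarrow> real) \<Rightarrow> real \<Rightarrow> real" where
  "cont_rep a b u =
     (SOME g. continuous_on {a..b} g \<and> (AE x in lebesgue_on {a<..<b}. g x = u x))"

text \<open>The derivatives of \<open>u \<in> sobolev n a b\<close> as pointwise functions: continuous representatives
  below order \<open>n\<close>, an arbitrary representative at order \<open>n\<close>.\<close>

definition sderiv :: "nat \<Rightarrow> real \<Rightarrow> real \<Rightarrow> nat \<Rightarrow> (real \<Rightarrow> real) \<Rightarrow> real \<Rightarrow> real" where
  "sderiv n a b i u =
     (if i < n then cont_rep a b (weak_deriv a b i u) else weak_deriv a b i u)"

definition endpoint_cond ::
    "nat \<Rightarrow> real \<Rightarrow> real \<Rightarrow> nat \<Rightarrow> (real \<Rightarrow> real) \<Rightarrow> real \<Rightarrow> real \<Rightarrow> bool" where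
  "endpoint_cond n a b i u e c \<longleftrightarrow>
     (if i < n then sderiv n a b i u e = c
      else \<exists>g. (AE x in lebesgue_on {a<..<b}. g x = weak_deriv a b i u x) \<and>
               continuous (at e within {a..b}) g \<and> g e = c)"

definition admissible ::
    "nat \<Rightarrow> real \<Rightarrow> real \<Rightarrow> nat set \<Rightarrow> nat set \<Rightarrow> (nat \<Rightarrow> real) \<Rightarrow> (nat \<Rightarrow> real) \<Rightarrow> (real \<Rightarrow> real) set" where
  "admissible n a b N N' \<alpha> \<beta> =
     {u \<in> sobolev n a b. (\<forall>i\<in>N. endpoint_cond n a b i u a (\<alpha> i)) \<and>
                         (\<forall>j\<in>N'. endpoint_cond n a b j u b (\<beta> j))}"

definition local_extremum ::
    "nat \<Rightarrow> real \<Rightarrow> real \<Rightarrow> (real \<Rightarrow> real) set \<Rightarrow> ((real \<Rightarrow> real) \<Rightarrow> real) \<Rightarrow> (real \<Rightarrow> real) \<Rightarrow> bool" where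
  "local_extremum n a b A F u0 \<longleftrightarrow>
     (\<exists>\<epsilon>>0. (\<forall>u\<in>A. sobolev_norm n a b (\<lambda>x. u x - u0 x) < \<epsilon> \<longrightarrow> F u \<ge> F u0) \<or>
            (\<forall>u\<in>A. sobolev_norm n a b (\<lambda>x. u x - u0 x) < \<epsilon> \<longrightarrow> F u \<le> F u0))"

section \<open>Functions of n + 2 real variables\<close>

text \<open>A point \<open>(x\<^sub>1, \<dots>, x\<^sub>m)\<close> is an extensional function on \<open>{1..m}\<close>. The product topology on
  \<open>nat \<Rightarrow> real\<close> induces the usual topology on the set of these points.\<close>

definition dom_f :: "nat \<Rightarrow> real \<Rightarrow> real \<Rightarrow> (nat \<Rightarrow> real) set" where
  "dom_f n a b = {x \<in> {1..n+2} \<rightarrow>\<^sub>E UNIV. x 1 \<in> {a..b}}"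

text \<open>The point \<open>(t, y 0, \<dots>, y n)\<close>.\<close>

definition point :: "nat \<Rightarrow> real \<Rightarrow> (nat \<Rightarrow> real) \<Rightarrow> nat \<Rightarrow> real" where
  "point n t y = (\<lambda>k\<in>{1..n+2}. if k = 1 then t else y (k - 2))"

text \<open>Partial derivatives are taken relative to the domain \<open>D\<close>, hence are one-sided where the
  coordinate line through the point meets \<open>D\<close> in an interval having the point as endpoint.\<close>

definition pdifferentiable ::
    "(nat \<Rightarrow> real) set \<Rightarrow> nat \<Rightarrow> ((nat \<Rightarrow> real) \<Rightarrow> real) \<Rightarrow> (nat \<Rightarrow> real) \<Rightarrow> bool" where
  "pdifferentiable D i f x \<longleftrightarrow>
     (\<lambda>s. f (x(i := s))) differentiable (at (x i) within {s. x(i := s) \<in> D})"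

definition pderivative ::
    "(nat \<Rightarrow> real) set \<Rightarrow> nat \<Rightarrow> ((nat \<Rightarrow> real) \<Rightarrow> real) \<Rightarrow> (nat \<Rightarrow> real) \<Rightarrow> real" where
  "pderivative D i f x =
     vector_derivative (\<lambda>s. f (x(i := s))) (at (x i) within {s. x(i := s) \<in> D})"

definition cont_second_partials ::
    "(nat \<Rightarrow> real) set \<Rightarrow> nat set \<Rightarrow> ((nat \<Rightarrow> real) \<Rightarrow> real) \<Rightarrow> bool" where
  "cont_second_partials D I f \<longleftrightarrow>
     (\<forall>i\<in>I. \<forall>x\<in>D. pdifferentiable D i f x) \<and>
     (\<forall>i\<in>I. \<forall>j\<in>I. (\<forall>x\<in>D. pdifferentiable D j (pderivative D i f) x) \<and>
                  continuous_on D (pderivative D j (pderivative D i f)))"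

definition functional ::
    "nat \<Rightarrow> real \<Rightarrow> real \<Rightarrow> ((nat \<Rightarrow> real) \<Rightarrow> real) \<Rightarrow> (real \<Rightarrow> real) \<Rightarrow> real" where
  "functional n a b f u =
     (LINT t|lebesgue_on {a..b}. f (point n t (\<lambda>i. sderiv n a b i u t)))"

definition psi ::
    "nat \<Rightarrow> real \<Rightarrow> real \<Rightarrow> ((nat \<Rightarrow> real) \<Rightarrow> real) \<Rightarrow> (real \<Rightarrow> real) \<Rightarrow> real \<Rightarrow> real \<Rightarrow> real" where
  "psi n a b f u0 t s =
     pderivative (dom_f n a b) (n + 2) f
       (point n t (\<lambda>i. if i < n then sderiv n a b i u0 t else s))"

definition Ck_on :: "nat \<Rightarrow> real set \<Rightarrow> (real \<Rightarrow> real) \<Rightarrow> bool" where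
  "Ck_on k S g \<longleftrightarrow>
     (\<exists>G :: nat \<Rightarrow> real \<Rightarrow> real.
        (\<forall>x\<in>S. G 0 x = g x) \<and>
        (\<forall>i<k. \<forall>x\<in>S. (G i has_real_derivative G (Suc i) x) (at x within S)) \<and>
        (\<forall>i\<le>k. continuous_on S (G i)))"

end

theory Submission
  imports Defs
begin

text \<open>
  Adding \<open>s * \<phi> x\<close> with a test function \<open>\<phi>\<close> to the extremal \<open>u0\<close> does not touch the endpoint
  conditions, because \<open>\<phi>\<close> vanishes near both endpoints. Hence the value of the functional at
  \<open>u0 + s \<phi>\<close>, as a function of \<open>s\<close>, has a local extremum at \<open>0\<close>. The growth bounds allow
  differentiation under the integral (\<open>first_variation\<close>), and the derivative must vanish: writing
  \<open>A i\<close> for the partial derivative of \<open>f\<close> with respect to the \<open>i\<close>-th derivative of the unknown,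
  evaluated along \<open>u0\<close>, the integral of \<open>\<Sum>i\<le>n. A i * (deriv ^^ i) \<phi>\<close> is zero for every \<open>\<phi>\<close>
  (\<open>weak_euler_lagrange\<close>).

  Integration by parts removes the terms one after the other, starting with the one of order zero
  (\<open>du_bois_reymond_chain\<close>). The outcome is that \<open>A n\<close> equals almost everywhere the last member of a
  sequence with \<open>E 0 = 0\<close> and \<open>E (j + 1) t = K j + \<integral>\<^sub>a\<^sup>t (A j - E j)\<close>. In particular \<open>E n\<close> is
  continuous although nothing is known yet about the \<open>A j\<close> beyond integrability.

  Now \<open>A n t\<close> is \<open>\<psi>(t, u0\<^sup>(\<^sup>n\<^sup>)(t))\<close>, and each \<open>\<psi>(t, \<cdot>)\<close> is an increasing bijection. So the
  \<open>n\<close>-th derivative of \<open>u0\<close> agrees almost everywhere with the solution \<open>w\<close> of \<open>\<psi>(t, w t) = E n t\<close>,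
  which is continuous (\<open>continuous_implicit_function\<close>). Hence \<open>u0\<close> is \<open>n\<close> times continuously
  differentiable. This feeds back: the \<open>A j\<close> now agree almost everywhere with continuous functions,
  therefore \<open>E n\<close> is continuously differentiable, and differentiating \<open>\<psi>(t, w t) = E n t\<close> implicitly
  (\<open>implicit_derivative\<close>) shows the same for \<open>w\<close>. The second partial derivatives of \<open>f\<close> enter here,
  and \<open>\<partial>\<psi>/\<partial>s\<close> appears as the denominator.

  The case \<open>n = 1\<close> of the same chain yields the continuous representatives of Sobolev functions
  (\<open>weak_primitive\<close>). Test functions are built from \<open>exp (- 1 / x)\<close>.
\<close>

section \<open>Functions with continuous partial derivatives\<close>

lemma tendsto_coordinatewise:
  fixes Y :: "'a \<Rightarrow> nat \<Rightarrow> real"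
  assumes "\<And>j. ((\<lambda>t. Y t j) \<longlongrightarrow> x j) F"
  shows "(Y \<longlongrightarrow> x) F"
proof -
  have "limitin (product_topology (\<lambda>_. euclidean) UNIV) Y x F"
    using assms by (subst limitin_componentwise) (auto simp: limitin_canonical_iff)
  then show ?thesis
    by (simp add: euclidean_product_topology limitin_canonical_iff)
qed

text \<open>A common abstraction of boxes: two points of \<open>D\<close> differ only in the coordinates \<open>1, \<dots>, m\<close>, and \<open>D\<close>
  contains every point whose coordinates lie between theirs. This is all that is needed to move from
  one point of \<open>D\<close> to another by changing one coordinate at a time.\<close>

definition coord_box :: "nat \<Rightarrow> (nat \<Rightarrow> real) set \<Rightarrow> bool" where
  "coord_box m D \<longleftrightarrow> (\<forall>x\<in>D. \<forall>y\<in>D. (\<forall>j. j \<notin> {1..m} \<longrightarrow> x j = y j) \<and>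
     (\<forall>z. (\<forall>j. z j \<in> closed_segment (x j) (y j)) \<longrightarrow> z \<in> D))"

lemma coord_boxD:
  assumes "coord_box m D" "x \<in> D" "y \<in> D"
  shows "j \<notin> {1..m} \<Longrightarrow> x j = y j"
    and "(\<And>j. z j \<in> closed_segment (x j) (y j)) \<Longrightarrow> z \<in> D"
  using assms unfolding coord_box_def by blast+

lemma coord_box_dom_f: "coord_box (n + 2) (dom_f n a b)"
  unfolding coord_box_def dom_f_def
proof (intro ballI conjI allI impI; clarify?)
  fix x y :: "nat \<Rightarrow> real" and z j
  assume *: "x \<in> {1..n+2} \<rightarrow>\<^sub>E UNIV" "y \<in> {1..n+2} \<rightarrow>\<^sub>E UNIV"
  show "x j = y j" if "j \<notin> {1..n+2}" for j
    using * that by (auto simp: PiE_def extensional_def)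
  assume **: "x 1 \<in> {a..b}" "y 1 \<in> {a..b}" "\<forall>j. z j \<in> closed_segment (x j) (y j)"
  have "z 1 \<in> {a..b}"
    using ** closed_segment_subset[of "x 1" "{a..b}" "y 1"] by auto
  moreover have "z j = undefined" if "j \<notin> {1..n+2}" for j
  proof -
    have "x j = undefined" "y j = undefined" using * that by (auto simp: PiE_def extensional_def)
    then show ?thesis using **(3)[rule_format, of j] by simp
  qed
  ultimately show "z \<in> {1..n+2} \<rightarrow>\<^sub>E UNIV \<and> z 1 \<in> {a..b}"
    by (auto simp: PiE_def extensional_def)
qed

lemma pderivative_works:
  assumes "pdifferentiable D i g x"
  shows "((\<lambda>s. g (x(i := s))) has_vector_derivative pderivative D i g x)
           (at (x i) within {s. x(i := s) \<in> D})"
  using assms unfolding pdifferentiable_def pderivative_def by (simp add: vector_derivative_works)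

text \<open>The mean value theorem on the coordinate line through \<open>z\<close>.\<close>

lemma mvt_coordinate:
  assumes D: "coord_box m D" and k: "k \<in> {1..m}"
    and diff: "\<And>x. x \<in> D \<Longrightarrow> pdifferentiable D k g x"
    and z: "z \<in> D" "z(k := s) \<in> D"
  shows "\<exists>r \<in> closed_segment (z k) s. g (z(k := s)) - g z = pderivative D k g (z(k := r)) * (s - z k)"
proof -
  have inD: "z(k := r) \<in> D" if "r \<in> closed_segment (z k) s" for r
    by (rule coord_boxD(2)[OF D z]) (use that in auto)
  have der: "((\<lambda>s. g (z(k := s))) has_derivative (\<lambda>h. pderivative D k g (z(k := r)) * h))
               (at r within closed_segment (z k) s)" if "r \<in> closed_segment (z k) s" for r
  proof -
    have "((\<lambda>s. g (z(k := s))) has_vector_derivative pderivative D k g (z(k := r)))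
           (at r within {s. z(k := s) \<in> D})"
      using pderivative_works[OF diff[OF inD[OF that]]] by simp
    then show ?thesis
      unfolding has_vector_derivative_def
      by (rule has_derivative_subset[THEN has_derivative_eq_rhs]) (auto simp: inD)
  qed
  consider "z k \<le> s" | "s \<le> z k" by linarith
  then show ?thesis
  proof cases
    case 1
    then have "\<exists>r\<in>{z k..s}. g (z(k := s)) - g (z(k := z k)) = pderivative D k g (z(k := r)) * (s - z k)"
      using der by (intro mvt_very_simple[where f = "\<lambda>s. g (z(k := s))" and
          f' = "\<lambda>r h. pderivative D k g (z(k := r)) * h"]) (auto simp: closed_segment_eq_real_ivl)
    with 1 show ?thesis by (auto simp: closed_segment_eq_real_ivl)
  next
    case 2
    then have seg: "closed_segment (z k) s = {s..z k}" by (auto simp: closed_segment_eq_real_ivl)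
    from 2 have "\<exists>r\<in>{s..z k}. g (z(k := z k)) - g (z(k := s)) = pderivative D k g (z(k := r)) * (z k - s)"
      using der by (intro mvt_very_simple[where f = "\<lambda>s. g (z(k := s))" and
          f' = "\<lambda>r h. pderivative D k g (z(k := r)) * h"])
        (auto simp: seg)
    then obtain r where "r \<in> {s..z k}" "g z - g (z(k := s)) = pderivative D k g (z(k := r)) * (z k - s)"
      by auto
    with 2 show ?thesis
      by (intro bexI[of _ r]) (auto simp: closed_segment_eq_real_ivl algebra_simps)
  qed
qed

text \<open>The increment is telescoped along the path that changes the coordinates \<open>1, \<dots>, m\<close> in turn, and
  the mean value theorem is applied to each step. This replaces total differentiability, for which
  the space of points carries no norm.\<close>

lemma increment_coordinates:
  assumes D: "coord_box m D"
    and diff: "\<And>k x. k \<in> {1..m} \<Longrightarrow> x \<in> D \<Longrightarrow> pdifferentiable D k g x"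
    and xy: "x \<in> D" "y \<in> D"
  shows "\<exists>\<xi>. (\<forall>k\<in>{1..m}. \<forall>j. \<xi> k j \<in> closed_segment (x j) (y j)) \<and>
    g y - g x = (\<Sum>k\<in>{1..m}. pderivative D k g (\<xi> k) * (y k - x k))"
proof -
  \<comment> \<open>The first \<open>k\<close> coordinates have already been moved from \<open>x\<close> to \<open>y\<close>.\<close>
  define z where "z k = (\<lambda>j. if j \<le> k then y j else x j)" for k :: nat
  have out: "x j = y j" if "j \<notin> {1..m}" for j
    using D xy that unfolding coord_box_def by blast
  have z0: "z 0 = x" using out[of 0] by (auto simp: z_def)
  have zm: "z m = y" using out by (fastforce simp: z_def)
  have zD: "z k \<in> D" for k
    by (rule coord_boxD(2)[OF D xy]) (auto simp: z_def)
  have step: "z k = (z (k - 1))(k := y k)" and zk: "z (k - 1) k = x k" if "k \<in> {1..m}" for k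
    using that by (auto simp: z_def fun_eq_iff)
  have "\<exists>w. (\<forall>j. w j \<in> closed_segment (x j) (y j)) \<and>
            g (z k) - g (z (k - 1)) = pderivative D k g w * (y k - x k)" if k: "k \<in> {1..m}" for k
  proof -
    have "\<exists>r \<in> closed_segment (z (k - 1) k) (y k). g ((z (k - 1))(k := y k)) - g (z (k - 1)) =
            pderivative D k g ((z (k - 1))(k := r)) * (y k - z (k - 1) k)"
      by (rule mvt_coordinate[OF D k diff[OF k]]) (use zD zD[of k, unfolded step[OF k]] in auto)
    then obtain r where "r \<in> closed_segment (x k) (y k)"
      "g (z k) - g (z (k - 1)) = pderivative D k g ((z (k - 1))(k := r)) * (y k - x k)"
      unfolding step[OF k, symmetric] zk[OF k] by blast
    then show ?thesis
      by (intro exI[of _ "(z (k - 1))(k := r)"]) (auto simp: z_def)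
  qed
  then obtain \<xi> where \<xi>: "\<And>k j. k \<in> {1..m} \<Longrightarrow> \<xi> k j \<in> closed_segment (x j) (y j)"
    "\<And>k. k \<in> {1..m} \<Longrightarrow> g (z k) - g (z (k - 1)) = pderivative D k g (\<xi> k) * (y k - x k)"
    by metis
  have "g y - g x = (\<Sum>k\<in>{1..m}. g (z k) - g (z (k - 1)))"
    using sum_telescope''[of 0 m "\<lambda>k. g (z k)"] by (simp add: z0 zm atLeastSucAtMost_greaterThanAtMost)
  also have "\<dots> = (\<Sum>k\<in>{1..m}. pderivative D k g (\<xi> k) * (y k - x k))"
    by (intro sum.cong refl \<xi>(2))
  finally show ?thesis using \<xi>(1) by (intro exI[of _ \<xi>]) simp
qed

text \<open>Along a family of points converging to \<open>x\<close>, the increment is a linear form in the coordinate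
  differences whose coefficients converge to the partial derivatives at \<open>x\<close>. Continuity, the chain
  rule and implicit differentiation are all read off from this.\<close>

lemma increment_limit:
  fixes Y :: "'a \<Rightarrow> nat \<Rightarrow> real"
  assumes D: "coord_box m D"
    and diff: "\<And>k x. k \<in> {1..m} \<Longrightarrow> x \<in> D \<Longrightarrow> pdifferentiable D k g x"
    and cont: "\<And>k. k \<in> {1..m} \<Longrightarrow> continuous_on D (pderivative D k g)"
    and x: "x \<in> D" and Y: "eventually (\<lambda>t. Y t \<in> D) F"
    and lim: "\<And>j. ((\<lambda>t. Y t j) \<longlongrightarrow> x j) F"
  obtains P where "\<And>t. Y t \<in> D \<Longrightarrow> g (Y t) - g x = (\<Sum>k\<in>{1..m}. P k t * (Y t k - x k))"
    and "\<And>k. k \<in> {1..m} \<Longrightarrow> (P k \<longlongrightarrow> pderivative D k g x) F"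
proof -
  have "\<forall>t. \<exists>\<xi>. Y t \<in> D \<longrightarrow> (\<forall>k\<in>{1..m}. \<forall>j. \<xi> k j \<in> closed_segment (x j) (Y t j)) \<and>
     g (Y t) - g x = (\<Sum>k\<in>{1..m}. pderivative D k g (\<xi> k) * (Y t k - x k))"
    using increment_coordinates[OF D diff x] by simp
  from choice[OF this] obtain \<xi> where \<xi>0: "\<forall>t. Y t \<in> D \<longrightarrow>
     (\<forall>k\<in>{1..m}. \<forall>j. \<xi> t k j \<in> closed_segment (x j) (Y t j)) \<and>
     g (Y t) - g x = (\<Sum>k\<in>{1..m}. pderivative D k g (\<xi> t k) * (Y t k - x k))" ..
  then have \<xi>: "\<And>t k j. Y t \<in> D \<Longrightarrow> k \<in> {1..m} \<Longrightarrow> \<xi> t k j \<in> closed_segment (x j) (Y t j)"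
     "\<And>t. Y t \<in> D \<Longrightarrow> g (Y t) - g x = (\<Sum>k\<in>{1..m}. pderivative D k g (\<xi> t k) * (Y t k - x k))"
    by blast+
  have "((\<lambda>t. pderivative D k g (\<xi> t k)) \<longlongrightarrow> pderivative D k g x) F" if k: "k \<in> {1..m}" for k
  proof -
    have "((\<lambda>t. \<xi> t k) \<longlongrightarrow> x) F"
    proof (rule tendsto_coordinatewise)
      fix j
      have "((\<lambda>t. \<xi> t k j - x j) \<longlongrightarrow> 0) F"
      proof (rule Lim_null_comparison)
        show "\<forall>\<^sub>F t in F. norm (\<xi> t k j - x j) \<le> \<bar>Y t j - x j\<bar>"
          using Y by eventually_elim (use \<xi>(1)[OF _ k, of _ j] in \<open>force simp: closed_segment_eq_real_ivl split: if_splits\<close>)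
        show "((\<lambda>t. \<bar>Y t j - x j\<bar>) \<longlongrightarrow> 0) F"
          using tendsto_rabs[OF tendsto_diff[OF lim[of j] tendsto_const[of "x j"]]] by simp
      qed
      then show "((\<lambda>t. \<xi> t k j) \<longlongrightarrow> x j) F" by (simp add: LIM_zero_iff)
    qed
    moreover have "\<forall>\<^sub>F t in F. \<xi> t k \<in> D"
      using Y by eventually_elim (use D x \<xi>(1)[OF _ k] in \<open>unfold coord_box_def, blast\<close>)
    ultimately show ?thesis
      using cont[OF k] x by (metis continuous_on_tendsto_compose)
  qed
  then show thesis using \<xi>(2) that[of "\<lambda>k t. pderivative D k g (\<xi> t k)"] by blast
qed

lemma continuous_on_partials:
  assumes D: "coord_box m D"
    and diff: "\<And>k x. k \<in> {1..m} \<Longrightarrow> x \<in> D \<Longrightarrow> pdifferentiable D k g x"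
    and cont: "\<And>k. k \<in> {1..m} \<Longrightarrow> continuous_on D (pderivative D k g)"
  shows "continuous_on D g"
  unfolding continuous_on_def
proof
  fix x assume x: "x \<in> D"
  have ev: "eventually (\<lambda>t. t \<in> D) (at x within D)" by (simp add: eventually_at_filter)
  have lim: "((\<lambda>t. t j) \<longlongrightarrow> x j) (at x within D)" for j
    using continuous_on_subset[OF continuous_on_product_coordinates[of j] subset_UNIV[of D]] x
    by (auto simp: continuous_on_def)
  obtain P where P: "\<And>t. t \<in> D \<Longrightarrow> g t - g x = (\<Sum>k\<in>{1..m}. P k t * (t k - x k))"
    "\<And>k. k \<in> {1..m} \<Longrightarrow> (P k \<longlongrightarrow> pderivative D k g x) (at x within D)"
    using increment_limit[OF D diff cont x ev lim] by blast
  have "((\<lambda>t. g x + (\<Sum>k\<in>{1..m}. P k t * (t k - x k))) \<longlongrightarrow> g x + (\<Sum>k\<in>{1..m}. pderivative D k g x * (x k - x k))) (at x within D)"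
    by (intro tendsto_intros P(2) lim)
  then have "((\<lambda>t. g x + (\<Sum>k\<in>{1..m}. P k t * (t k - x k))) \<longlongrightarrow> g x) (at x within D)" by simp
  moreover have "\<forall>\<^sub>F t in at x within D. g x + (\<Sum>k\<in>{1..m}. P k t * (t k - x k)) = g t"
    using ev by eventually_elim (drule P(1), simp)
  ultimately show "(g \<longlongrightarrow> g x) (at x within D)" by (rule Lim_transform_eventually)
qed

lemma chain_rule_partials:
  fixes Y :: "real \<Rightarrow> nat \<Rightarrow> real"
  assumes D: "coord_box m D"
    and diff: "\<And>k x. k \<in> {1..m} \<Longrightarrow> x \<in> D \<Longrightarrow> pdifferentiable D k g x"
    and cont: "\<And>k. k \<in> {1..m} \<Longrightarrow> continuous_on D (pderivative D k g)"
    and Y: "\<And>t. t \<in> S \<Longrightarrow> Y t \<in> D" and t0: "t0 \<in> S"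
    and der: "\<And>k. k \<in> {1..m} \<Longrightarrow> ((\<lambda>t. Y t k) has_real_derivative Y' k) (at t0 within S)"
  shows "((\<lambda>t. g (Y t)) has_real_derivative (\<Sum>k\<in>{1..m}. pderivative D k g (Y t0) * Y' k)) (at t0 within S)"
proof -
  have ev: "\<forall>\<^sub>F t in at t0 within S. t \<in> S" by (simp add: eventually_at_filter)
  have evD: "\<forall>\<^sub>F t in at t0 within S. Y t \<in> D" using ev by eventually_elim (rule Y)
  have lim: "((\<lambda>t. Y t j) \<longlongrightarrow> Y t0 j) (at t0 within S)" for j
  proof (cases "j \<in> {1..m}")
    case True
    then show ?thesis using DERIV_continuous[OF der[OF True]] by (simp add: continuous_within)
  next
    case False
    have "\<forall>\<^sub>F t in at t0 within S. Y t0 j = Y t j"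
      using evD by eventually_elim (use D Y[OF t0] False in \<open>unfold coord_box_def, blast\<close>)
    then show ?thesis by (rule Lim_transform_eventually[OF tendsto_const])
  qed
  obtain P where P: "\<And>t. Y t \<in> D \<Longrightarrow> g (Y t) - g (Y t0) = (\<Sum>k\<in>{1..m}. P k t * (Y t k - Y t0 k))"
    "\<And>k. k \<in> {1..m} \<Longrightarrow> (P k \<longlongrightarrow> pderivative D k g (Y t0)) (at t0 within S)"
    using increment_limit[OF D diff cont Y[OF t0] evD lim] by blast
  have "((\<lambda>t. \<Sum>k\<in>{1..m}. P k t * ((Y t k - Y t0 k) / (t - t0))) \<longlongrightarrow> (\<Sum>k\<in>{1..m}. pderivative D k g (Y t0) * Y' k)) (at t0 within S)"
    by (intro tendsto_sum tendsto_mult P(2)) (use der in \<open>auto simp: has_field_derivative_iff\<close>)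
  moreover have "\<forall>\<^sub>F t in at t0 within S. (\<Sum>k\<in>{1..m}. P k t * ((Y t k - Y t0 k) / (t - t0))) = (g (Y t) - g (Y t0)) / (t - t0)"
    using evD by eventually_elim (simp add: P(1) sum_divide_distrib)
  ultimately show ?thesis
    unfolding has_field_derivative_iff by (rule Lim_transform_eventually)
qed

section \<open>Smooth functions and test functions\<close>

definition smooth :: "(real \<Rightarrow> real) \<Rightarrow> bool" where
  "smooth f \<longleftrightarrow> (\<forall>k x. (deriv ^^ k) f differentiable (at x))"

lemma smooth_differentiable: "smooth f \<Longrightarrow> f differentiable (at x)"
  unfolding smooth_def by (metis funpow_0)

lemma smooth_has_deriv: "smooth f \<Longrightarrow> (f has_real_derivative deriv f x) (at x)"
  using smooth_differentiable DERIV_deriv_iff_real_differentiable by blast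

lemma smooth_iff_deriv: "smooth f \<longleftrightarrow> (\<forall>x. f differentiable (at x)) \<and> smooth (deriv f)"
proof -
  have split0: "(\<forall>k. P k) \<longleftrightarrow> P 0 \<and> (\<forall>k. P (Suc k))" for P :: "nat \<Rightarrow> bool"
    by (metis nat.exhaust)
  have "smooth f \<longleftrightarrow> (\<forall>x. (deriv ^^ 0) f differentiable (at x)) \<and>
      (\<forall>k x. (deriv ^^ Suc k) f differentiable (at x))"
    unfolding smooth_def by (rule split0)
  then show ?thesis
    unfolding smooth_def funpow_Suc_right by simp
qed

lemma smooth_deriv: "smooth f \<Longrightarrow> smooth (deriv f)"
  by (simp add: smooth_iff_deriv[of f])

lemma smooth_higher_deriv: "smooth f \<Longrightarrow> smooth ((deriv ^^ k) f)"
  by (induction k) (auto intro: smooth_deriv)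

lemma smooth_continuous_on: "smooth f \<Longrightarrow> continuous_on S f"
  by (intro continuous_at_imp_continuous_on ballI DERIV_isCont[OF smooth_has_deriv])

lemma smooth_const: "smooth (\<lambda>x. c)"
proof -
  have "(deriv ^^ k) (\<lambda>x::real. c) = (\<lambda>x. if k = 0 then c else 0)" for k
    by (induction k) auto
  then show ?thesis unfolding smooth_def by auto
qed

text \<open>For \<open>p = 1\<close> this is the standard smooth function that vanishes exactly on the nonpositive reals. The
  polynomial factor makes the family closed under differentiation.\<close>

definition flat :: "real poly \<Rightarrow> real \<Rightarrow> real" where
  "flat p x = (if x > 0 then poly p (1 / x) * exp (- (1 / x)) else 0)"

lemma poly_times_exp_tendsto_0: "((\<lambda>y::real. poly q y * exp (- y)) \<longlongrightarrow> 0) at_top"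
proof -
  have "((\<lambda>y. \<Sum>i\<le>degree q. coeff q i * (y ^ i / exp y)) \<longlongrightarrow> (\<Sum>i\<le>degree q. coeff q i * 0)) at_top"
    by (intro tendsto_intros tendsto_power_div_exp_0)
  moreover have "(\<Sum>i\<le>degree q. coeff q i * (y ^ i / exp y)) = poly q y * exp (- y)" for y
    by (simp add: poly_altdef exp_minus sum_distrib_right divide_inverse mult.assoc)
  ultimately show ?thesis by simp
qed

text \<open>For positive arguments, \<open>p (1/x) * exp (-1/x)\<close> has the derivative
  \<open>(p - p') (1/x) * (1/x)\<^sup>2 * exp (-1/x)\<close>. At \<open>0\<close> both one-sided difference quotients tend to \<open>0\<close>,
  since the exponential beats every polynomial in \<open>1/x\<close>.\<close>

lemma flat_has_derivative:
  "(flat p has_real_derivative flat ((p - pderiv p) * [:0, 0, 1:]) x) (at x)"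
proof -
  consider "x > 0" | "x < 0" | "x = 0" by linarith
  then show ?thesis
  proof cases
    case 1
    have "((\<lambda>x. poly p (1 / x) * exp (- (1 / x))) has_real_derivative
            flat ((p - pderiv p) * [:0, 0, 1:]) x) (at x)"
      using 1 by (auto intro!: derivative_eq_intros poly_DERIV[THEN DERIV_chain2]
          simp: flat_def field_simps power2_eq_square)
    then show ?thesis
      by (rule has_field_derivative_transform_within_open[of _ _ _ "{0<..}"]) (use 1 in \<open>auto simp: flat_def\<close>)
  next
    case 2
    have "((\<lambda>x. 0) has_real_derivative flat ((p - pderiv p) * [:0, 0, 1:]) x) (at x)"
      using 2 by (auto simp: flat_def)
    then show ?thesis
      by (rule has_field_derivative_transform_within_open[of _ _ _ "{..<0}"]) (use 2 in \<open>auto simp: flat_def\<close>)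
  next
    case 3
    have "((\<lambda>h. poly (p * [:0, 1:]) (inverse h) * exp (- inverse h)) \<longlongrightarrow> 0) (at_right 0)"
      by (rule filterlim_compose[OF poly_times_exp_tendsto_0 filterlim_inverse_at_top_right])
    moreover have "\<forall>\<^sub>F h in at_right 0. poly (p * [:0, 1:]) (inverse h) * exp (- inverse h) = flat p h / h"
      by (auto simp: eventually_at_filter flat_def divide_inverse)
    ultimately have r: "((\<lambda>h. flat p h / h) \<longlongrightarrow> 0) (at_right 0)" by (rule Lim_transform_eventually)
    have "((\<lambda>h. flat p h / h) \<longlongrightarrow> 0) (at_left 0)"
      by (rule tendsto_eventually) (auto simp: eventually_at_filter flat_def)
    with r have "((\<lambda>h. flat p h / h) \<longlongrightarrow> 0) (at 0)" by (simp add: filterlim_at_split)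
    then show ?thesis using 3 by (simp add: has_field_derivative_iff flat_def)
  qed
qed

text \<open>Closure of the smooth functions and the functions \<open>flat p\<close> under the operations needed below. Since the derivative of a member
  is again a member, all members are smooth, so that smoothness of products and compositions follows
  without a Leibniz formula for higher derivatives.\<close>

inductive smooth_closure :: "(real \<Rightarrow> real) \<Rightarrow> bool" where
  smooth: "smooth f \<Longrightarrow> smooth_closure f"
| flat: "smooth_closure (flat p)"
| add: "smooth_closure f \<Longrightarrow> smooth_closure g \<Longrightarrow> smooth_closure (\<lambda>x. f x + g x)"
| mult: "smooth_closure f \<Longrightarrow> smooth_closure g \<Longrightarrow> smooth_closure (\<lambda>x. f x * g x)"
| affine: "smooth_closure f \<Longrightarrow> smooth_closure (\<lambda>x. f (c * x + d))"

lemma smooth_closure_deriv: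
  "smooth_closure f \<Longrightarrow> (\<forall>x. f differentiable (at x)) \<and> smooth_closure (deriv f)"
proof (induction rule: smooth_closure.induct)
  case (smooth f)
  then show ?case by (auto intro: smooth_differentiable smooth_deriv smooth_closure.smooth)
next
  case (flat p)
  have "deriv (flat p) = flat ((p - pderiv p) * [:0, 0, 1:])"
    using flat_has_derivative DERIV_imp_deriv by blast
  then show ?case
    using flat_has_derivative[of p] by (auto simp: real_differentiable_def intro: smooth_closure.flat)
next
  case (add f g)
  then have "((\<lambda>x. f x + g x) has_real_derivative deriv f x + deriv g x) (at x)" for x
    by (auto intro!: derivative_intros simp: DERIV_deriv_iff_real_differentiable)
  then have "deriv (\<lambda>x. f x + g x) = (\<lambda>x. deriv f x + deriv g x)"
    by (intro ext DERIV_imp_deriv)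
  then show ?case using add by (auto intro: smooth_closure.add)
next
  case (mult f g)
  then have "((\<lambda>x. f x * g x) has_real_derivative f x * deriv g x + deriv f x * g x) (at x)" for x
    by (intro DERIV_mult') (auto simp: DERIV_deriv_iff_real_differentiable)
  then have "deriv (\<lambda>x. f x * g x) = (\<lambda>x. f x * deriv g x + deriv f x * g x)"
    by (intro ext DERIV_imp_deriv)
  then show ?case using mult by (auto intro: smooth_closure.intros)
next
  case (affine f c d)
  have *: "((\<lambda>x. f (c * x + d)) has_real_derivative deriv f (c * x + d) * c) (at x)" for x
    by (rule DERIV_chain2[where f = f]) 
      (use affine in \<open>auto intro!: derivative_eq_intros simp: DERIV_deriv_iff_real_differentiable\<close>)
  then have "deriv (\<lambda>x. f (c * x + d)) = (\<lambda>x. deriv f (c * x + d) * c)"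
    by (intro ext DERIV_imp_deriv)
  moreover have "smooth_closure (\<lambda>x. deriv f (c * x + d) * c)"
    by (rule smooth_closure.mult[OF smooth_closure.affine smooth_closure.smooth[OF smooth_const]])
      (use affine in simp)
  ultimately show ?case using * by (auto simp: real_differentiable_def)
qed

lemma smooth_closure_eq_smooth: "smooth_closure f \<longleftrightarrow> smooth f"
proof
  assume "smooth_closure f"
  then have "smooth_closure ((deriv ^^ k) f)" for k
    by (induction k) (auto dest: smooth_closure_deriv)
  then show "smooth f"
    unfolding smooth_def by (auto dest: smooth_closure_deriv)
qed (rule smooth_closure.smooth)

lemmas smooth_flat = smooth_closure.flat[unfolded smooth_closure_eq_smooth]
  and smooth_add = smooth_closure.add[unfolded smooth_closure_eq_smooth]
  and smooth_mult = smooth_closure.mult[unfolded smooth_closure_eq_smooth]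
  and smooth_affine = smooth_closure.affine[unfolded smooth_closure_eq_smooth]

lemma test_funI:
  assumes "smooth \<phi>" "a < c" "d < b" "\<And>x. x \<notin> {c..d} \<Longrightarrow> \<phi> x = 0"
  shows "test_fun a b \<phi>"
  using assms unfolding test_fun_def smooth_def[symmetric]
  by (auto intro!: exI[of _ "{c..d}"])

lemma test_fun_smooth: "test_fun a b \<phi> \<Longrightarrow> smooth \<phi>"
  unfolding test_fun_def smooth_def by blast

lemma test_fun_support:
  assumes "test_fun a b \<phi>" "a < b"
  obtains c d where "a < c" "c < d" "d < b" "\<And>x. x \<notin> {c..d} \<Longrightarrow> \<phi> x = 0"
proof -
  obtain K where K: "compact K" "K \<subseteq> {a<..<b}" "\<And>x. x \<notin> K \<Longrightarrow> \<phi> x = 0"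
    using assms unfolding test_fun_def by blast
  \<comment> \<open>Two extra points make the support nonempty with distinct least and greatest element.\<close>
  define K' where "K' = insert ((2 * a + b) / 3) (insert ((a + 2 * b) / 3) K)"
  have K': "compact K'" "K' \<noteq> {}" "K' \<subseteq> {a<..<b}" using K assms by (auto simp: K'_def)
  obtain c where c: "c \<in> K'" "\<And>x. x \<in> K' \<Longrightarrow> c \<le> x" using compact_attains_inf[OF K'(1,2)] by blast
  obtain d where d: "d \<in> K'" "\<And>x. x \<in> K' \<Longrightarrow> x \<le> d" using compact_attains_sup[OF K'(1,2)] by blast
  have "c \<le> (2 * a + b) / 3" by (rule c) (simp add: K'_def)
  moreover have "(a + 2 * b) / 3 \<le> d" by (rule d) (simp add: K'_def)
  ultimately have "c < d" using assms by auto
  moreover have "\<phi> x = 0" if "x \<notin> {c..d}" for x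
  proof (rule K(3))
    show "x \<notin> K" using c(2)[of x] d(2)[of x] that by (auto simp: K'_def)
  qed
  moreover have "a < c" "d < b" using K' c d by auto
  ultimately show thesis using that by blast
qed

lemma test_fun_outside: "test_fun a b \<phi> \<Longrightarrow> a < b \<Longrightarrow> x \<notin> {a<..<b} \<Longrightarrow> \<phi> x = 0"
  by (erule test_fun_support) auto

lemma test_fun_deriv:
  assumes "test_fun a b \<phi>" "a < b"
  shows "test_fun a b (deriv \<phi>)"
proof -
  obtain c d where cd: "a < c" "c < d" "d < b" "\<And>x. x \<notin> {c..d} \<Longrightarrow> \<phi> x = 0"
    using test_fun_support[OF assms] by blast
  have "deriv \<phi> x = 0" if "x \<notin> {c..d}" for x
  proof -
    have "(\<phi> has_real_derivative 0) (at x)"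
      by (rule has_field_derivative_transform_within_open[of "\<lambda>x. 0" _ _ "- {c..d}"])
        (use that cd in auto)
    then show ?thesis by (rule DERIV_imp_deriv)
  qed
  then show ?thesis
    using cd smooth_deriv[OF test_fun_smooth[OF assms(1)]] by (intro test_funI[of _ a c d b]) auto
qed

lemma test_fun_higher_deriv: "test_fun a b \<phi> \<Longrightarrow> a < b \<Longrightarrow> test_fun a b ((deriv ^^ k) \<phi>)"
  by (induction k) (auto intro: test_fun_deriv)

lemma test_fun_mult_smooth:
  assumes "smooth \<psi>" "test_fun a b \<phi>"
  shows "test_fun a b (\<lambda>x. \<psi> x * \<phi> x)"
  using assms smooth_mult[OF assms(1) test_fun_smooth[OF assms(2)]]
  unfolding test_fun_def smooth_def[symmetric] by auto

lemma test_fun_scale: "test_fun a b \<phi> \<Longrightarrow> test_fun a b (\<lambda>x. c * \<phi> x)"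
  by (rule test_fun_mult_smooth[OF smooth_const])

lemma test_fun_add:
  assumes "test_fun a b \<phi>" "test_fun a b \<psi>"
  shows "test_fun a b (\<lambda>x. \<phi> x + \<psi> x)"
proof -
  obtain K K' where "compact K" "K \<subseteq> {a<..<b}" "\<And>x. x \<notin> K \<Longrightarrow> \<phi> x = 0"
    "compact K'" "K' \<subseteq> {a<..<b}" "\<And>x. x \<notin> K' \<Longrightarrow> \<psi> x = 0"
    using assms unfolding test_fun_def by metis
  then have "compact (K \<union> K') \<and> K \<union> K' \<subseteq> {a<..<b} \<and> (\<forall>x. x \<notin> K \<union> K' \<longrightarrow> \<phi> x + \<psi> x = 0)"
    by auto
  then show ?thesis
    using smooth_add[OF assms[THEN test_fun_smooth]]
    unfolding test_fun_def smooth_def[symmetric] by blast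
qed

lemma deriv_scale: "smooth f \<Longrightarrow> (deriv ^^ k) (\<lambda>x. c * f x) = (\<lambda>x. c * (deriv ^^ k) f x)"
proof (induction k)
  case (Suc k)
  have "((\<lambda>x. c * (deriv ^^ k) f x) has_real_derivative c * deriv ((deriv ^^ k) f) x) (at x)" for x
    by (rule DERIV_cmult[OF smooth_has_deriv[OF smooth_higher_deriv[OF Suc.prems]]])
  then show ?case using Suc by (auto intro!: ext DERIV_imp_deriv)
qed auto

lemma deriv_add:
  "smooth f \<Longrightarrow> smooth g \<Longrightarrow> (deriv ^^ k) (\<lambda>x. f x + g x) = (\<lambda>x. (deriv ^^ k) f x + (deriv ^^ k) g x)"
proof (induction k)
  case (Suc k)
  have "((\<lambda>x. (deriv ^^ k) f x + (deriv ^^ k) g x) has_real_derivative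
     deriv ((deriv ^^ k) f) x + deriv ((deriv ^^ k) g) x) (at x)" for x
    by (intro DERIV_add smooth_has_deriv smooth_higher_deriv Suc.prems)
  then show ?case using Suc by (auto intro!: ext DERIV_imp_deriv)
qed auto

lemma test_fun_bounded:
  assumes "test_fun a b \<phi>" "a < b"
  obtains M where "\<And>x. \<bar>\<phi> x\<bar> \<le> M"
proof -
  have "bounded (\<phi> ` {a..b})"
    by (intro compact_imp_bounded compact_continuous_image smooth_continuous_on test_fun_smooth[OF assms(1)]) auto
  then obtain M where M: "\<forall>x\<in>{a..b}. \<bar>\<phi> x\<bar> \<le> M"
    unfolding bounded_iff by auto
  have "\<bar>\<phi> x\<bar> \<le> max M 0" for x
    using M test_fun_outside[OF assms, of x] by (cases "x \<in> {a<..<b}") (auto simp: le_max_iff_disj)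
  then show thesis by (rule that)
qed

lemma smooth_borel: "smooth f \<Longrightarrow> f \<in> borel_measurable borel"
  by (intro borel_measurable_continuous_onI smooth_continuous_on)

lemma smooth_borel_on: "smooth f \<Longrightarrow> f \<in> borel_measurable (lebesgue_on S)"
  by (intro measurable_restrict_space1 measurable_completion) (use smooth_borel in simp)

lemma integrable_times_test_fun:
  assumes "test_fun a b \<phi>" "a < b" "integrable (lebesgue_on {a<..<b}) g"
  shows "integrable (lebesgue_on {a<..<b}) (\<lambda>x. g x * \<phi> x)"
proof -
  obtain M where M: "\<And>x. \<bar>\<phi> x\<bar> \<le> M" using test_fun_bounded[OF assms(1,2)] by blast
  show ?thesis
  proof (rule Bochner_Integration.integrable_bound)
    show "integrable (lebesgue_on {a<..<b}) (\<lambda>x. M * g x)" using assms by auto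
    show "AE x in lebesgue_on {a<..<b}. norm (g x * \<phi> x) \<le> norm (M * g x)"
    proof (rule AE_I2)
      fix x
      have "\<bar>g x\<bar> * \<bar>\<phi> x\<bar> \<le> \<bar>g x\<bar> * \<bar>M\<bar>" using M[of x] by (intro mult_left_mono) auto
      then show "norm (g x * \<phi> x) \<le> norm (M * g x)" by (simp add: abs_mult mult.commute)
    qed
  qed (use assms smooth_borel_on[OF test_fun_smooth] in auto)
qed

section \<open>Integration against test functions\<close>

lemma sets_borel_open_intervals:
  "sets (borel :: real measure) = sigma_sets UNIV (range (\<lambda>(c, d). {c<..<d}))"
  unfolding borel_eq_box box_real by simp

text \<open>The open intervals form an intersection-stable generator of the Borel sets. The sets over which \<open>f\<close>
  integrates to zero are closed under complement and disjoint union, so all Borel sets are among them.\<close>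

lemma AE_zero_of_intervals:
  fixes f :: "real \<Rightarrow> real"
  assumes f: "integrable lborel f" and out: "\<And>x. x \<notin> {a<..<b} \<Longrightarrow> f x = 0"
    and int: "\<And>c d. (LINT x:{c<..<d}|lborel. f x) = 0"
  shows "AE x in lborel. f x = 0"
proof (rule sigma_finite_measure.density_zero[OF lborel.sigma_finite_measure_axioms f])
  have full: "(LINT x:UNIV|lborel. f x) = 0"
  proof -
    have "(LINT x:UNIV|lborel. f x) = (LINT x:{a<..<b}|lborel. f x)"
      unfolding set_lebesgue_integral_def
      by (rule Bochner_Integration.integral_cong) (use out in \<open>auto simp: indicator_def\<close>)
    then show ?thesis using int by simp
  qed
  have si: "set_integrable lborel A f" if "A \<in> sets borel" for A
    unfolding set_integrable_def using f that by (intro integrable_mult_indicator) auto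
  let ?G = "range (\<lambda>(c, d). {c<..<d::real})"
  fix A :: "real set" assume "A \<in> sets lborel"
  then have A: "A \<in> sigma_sets UNIV ?G"
    by (simp add: sets_borel_open_intervals)
  have stable: "Int_stable ?G"
  proof (rule Int_stableI_image)
    fix i j :: "real \<times> real"
    show "\<exists>k\<in>UNIV. (case i of (c, d) \<Rightarrow> {c<..<d}) \<inter> (case j of (c, d) \<Rightarrow> {c<..<d}) =
        (case k of (c, d) \<Rightarrow> {c<..<d})"
      by (intro bexI[of _ "(max (fst i) (fst j), min (snd i) (snd j))"]) (auto simp: split_beta)
  qed
  have "?G \<subseteq> Pow UNIV" by simp
  from stable this A show "(LINT x:A|lborel. f x) = 0"
  proof (induction A rule: sigma_sets_induct_disjoint)
    case (basic A)
    then show ?case using int by auto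
  next
    case empty
    then show ?case by (simp add: set_lebesgue_integral_def)
  next
    case (compl A)
    then have A: "A \<in> sets borel" by (simp add: sets_borel_open_intervals)
    have "(LINT x:UNIV|lborel. f x) = (LINT x:A|lborel. f x) + (LINT x:(UNIV - A)|lborel. f x)"
      using set_integral_Un[of A "UNIV - A" lborel f] A si by auto
    then show ?case using compl full by simp
  next
    case (union A)
    then have A: "A i \<in> sets borel" for i by (auto simp: sets_borel_open_intervals)
    have "(LINT x:(\<Union>i. A i)|lborel. f x) = (\<Sum>i. LINT x:A i|lborel. f x)"
      by (rule lebesgue_integral_countable_add) (use A si union in \<open>auto simp: disjoint_family_on_def\<close>)
    then show ?case using union by simp
  qed
qed

lemma AE_interval_iff_negligible:
  "(AE x in lebesgue_on {a<..<b::real}. P x) \<longleftrightarrow> negligible {x \<in> {a<..<b}. \<not> P x}"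
proof -
  have "(AE x in lebesgue_on {a<..<b}. P x) \<longleftrightarrow> {x \<in> space lebesgue. \<not> (x \<in> {a<..<b} \<longrightarrow> P x)} \<in> null_sets lebesgue"
    by (subst AE_restrict_space_iff) (auto simp only: completion.AE_iff_null_sets space_completion space_lborel sets_completionI_sets sets_lborel inf_top_right space_borel Int_UNIV_right borel_open open_greaterThanLessThan)
  also have "{x \<in> space lebesgue. \<not> (x \<in> {a<..<b} \<longrightarrow> P x)} = {x \<in> {a<..<b}. \<not> P x}" by auto
  finally show ?thesis by (simp add: negligible_iff_null_sets)
qed

lemma AE_lebesgue_neq: "AE x in lebesgue. x \<noteq> (c::real)"
  by (simp add: AE_completion_iff AE_lborel_singleton)

lemma AE_closed_interval_iff:
  "(AE x in lebesgue_on {a..b::real}. P x) \<longleftrightarrow> (AE x in lebesgue_on {a<..<b}. P x)"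
proof -
  have "(AE x in lebesgue. x \<in> {a..b} \<longrightarrow> P x) \<longleftrightarrow> (AE x in lebesgue. x \<in> {a<..<b} \<longrightarrow> P x)"
    (is "?l \<longleftrightarrow> ?r")
  proof
    assume ?r
    then show ?l using AE_lebesgue_neq[of a] AE_lebesgue_neq[of b] by eventually_elim auto
  qed (auto elim!: eventually_mono)
  then show ?thesis by (simp add: AE_restrict_space_iff)
qed

lemma measurable_closed_interval_iff:
  fixes f :: "real \<Rightarrow> real"
  shows "f \<in> borel_measurable (lebesgue_on {a..b}) \<longleftrightarrow> f \<in> borel_measurable (lebesgue_on {a<..<b})"
proof -
  have N: "{a, b} \<inter> {a..b} \<in> null_sets (lebesgue_on {a..b})"
    by (subst null_sets_restrict_space)
      (auto intro!: null_sets_completionI finite_imp_null_set_lborel)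
  have "{a..b} - {a, b} \<inter> {a..b} = {a<..<b}" by auto
  then show ?thesis using borel_measurable_diff_null[OF N, of f] by auto
qed

lemma integrable_closed_interval_iff:
  fixes f :: "real \<Rightarrow> real"
  shows "integrable (lebesgue_on {a..b}) f \<longleftrightarrow> integrable (lebesgue_on {a<..<b}) f"
    and "(LINT x|lebesgue_on {a..b}. f x) = (LINT x|lebesgue_on {a<..<b}. f x)"
proof -
  have *: "(integrable (lebesgue_on {a..b}) f \<longleftrightarrow> integrable (lebesgue_on {a<..<b}) f) \<and>
     (LINT x|lebesgue_on {a..b}. f x) = (LINT x|lebesgue_on {a<..<b}. f x)"
  proof (cases "f \<in> borel_measurable (lebesgue_on {a<..<b})")
    case True
    then have m: "f \<in> borel_measurable (lebesgue_on {a..b})" by (simp add: measurable_closed_interval_iff)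
    have 1: "(\<lambda>x. indicator {a..b} x *\<^sub>R f x) \<in> borel_measurable lebesgue"
      using m by (subst (asm) borel_measurable_restrict_space_iff) auto
    have 2: "(\<lambda>x. indicator {a<..<b} x *\<^sub>R f x) \<in> borel_measurable lebesgue"
      using True by (subst (asm) borel_measurable_restrict_space_iff) auto
    have ae: "AE x in lebesgue. indicator {a..b} x *\<^sub>R f x = indicator {a<..<b} x *\<^sub>R f x"
      using AE_lebesgue_neq[of a] AE_lebesgue_neq[of b]
      by eventually_elim (auto simp: indicator_def)
    show ?thesis
      using integrable_cong_AE[OF 1 2 ae] integral_cong_AE[OF 1 2 ae]
      by (simp add: integrable_restrict_space integral_restrict_space)
  next
    case False
    then have "\<not> integrable (lebesgue_on {a<..<b}) f" "\<not> integrable (lebesgue_on {a..b}) f"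
      using borel_measurable_integrable measurable_closed_interval_iff by blast+
    then show ?thesis by (simp add: not_integrable_integral_eq)
  qed
  then show "integrable (lebesgue_on {a..b}) f \<longleftrightarrow> integrable (lebesgue_on {a<..<b}) f"
    "(LINT x|lebesgue_on {a..b}. f x) = (LINT x|lebesgue_on {a<..<b}. f x)" by auto
qed

lemma integral_cong_AE_interval:
  fixes f g :: "real \<Rightarrow> real"
  assumes "AE x in lebesgue_on {a<..<b}. f x = g x" "t \<le> b"
  shows "integral {a..t} f = integral {a..t} g"
proof (rule integral_spike)
  show "negligible ({x \<in> {a<..<b}. f x \<noteq> g x} \<union> {a, b})"
    using assms by (intro negligible_Un) (auto simp: AE_interval_iff_negligible)
qed (use assms(2) in force)

text \<open>Fubini's theorem and the generator argument work with Borel functions on the whole line. Passing to a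
  Borel function that vanishes outside the interval changes no integral against Borel functions.\<close>

lemma borel_representative:
  fixes g :: "real \<Rightarrow> real"
  assumes g: "integrable (lebesgue_on {a<..<b}) g"
  obtains g' where "integrable lborel g'" "\<And>x. x \<notin> {a<..<b} \<Longrightarrow> g' x = 0"
    "AE x in lebesgue_on {a<..<b}. g' x = g x"
    "\<And>\<phi>. \<phi> \<in> borel_measurable borel \<Longrightarrow> (LINT x|lebesgue_on {a<..<b}. g x * \<phi> x) = (LINT x|lborel. g' x * \<phi> x)"
proof -
  have "integrable lebesgue (\<lambda>x. indicator {a<..<b} x *\<^sub>R g x)"
    using g by (subst (asm) integrable_restrict_space) auto
  then have g1: "integrable lebesgue (\<lambda>x. indicator {a<..<b} x * g x)" by simp
  then have "(\<lambda>x. indicator {a<..<b} x * g x) \<in> borel_measurable (completion lborel)"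
    by (rule borel_measurable_integrable)
  from completion_ex_borel_measurable_real[OF this] obtain g0 where
    g0: "g0 \<in> borel_measurable lborel" "AE x in lborel. indicator {a<..<b} x * g x = g0 x" by blast
  define g' where "g' x = indicator {a<..<b} x * g0 x" for x
  have g'b[measurable]: "g' \<in> borel_measurable lborel" unfolding g'_def using g0(1) by measurable
  have ae: "AE x in lebesgue. indicator {a<..<b} x * g x = g' x"
    using AE_completion[OF g0(2)]
  proof eventually_elim
    case (elim x)
    then show ?case by (cases "x \<in> {a<..<b}") (simp_all add: g'_def)
  qed
  have "integrable lebesgue g'"
    by (rule Bochner_Integration.integrable_cong_AE_imp[OF g1]) (use ae in \<open>auto intro: measurable_completion[OF g'b]\<close>)
  then have 1: "integrable lborel g'" by (simp add: integrable_completion)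
  have 2: "g' x = 0" if "x \<notin> {a<..<b}" for x using that by (simp add: g'_def)
  have 3: "AE x in lebesgue_on {a<..<b}. g' x = g x"
    using ae by (subst AE_restrict_space_iff) auto
  have "(LINT x|lebesgue_on {a<..<b}. g x * \<phi> x) = (LINT x|lborel. g' x * \<phi> x)"
    if [measurable]: "\<phi> \<in> borel_measurable borel" for \<phi>
  proof -
    have \<phi>m: "\<phi> \<in> borel_measurable lebesgue" by (rule measurable_completion) simp
    have "(LINT x|lebesgue_on {a<..<b}. g x * \<phi> x) = (LINT x|lebesgue. indicator {a<..<b} x * (g x * \<phi> x))"
      by (subst integral_restrict_space) auto
    also have "\<dots> = (LINT x|lebesgue. g' x * \<phi> x)"
    proof (rule integral_cong_AE)
      show "(\<lambda>x. indicator {a<..<b} x * (g x * \<phi> x)) \<in> borel_measurable lebesgue"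
        using borel_measurable_times[OF borel_measurable_integrable[OF g1] \<phi>m] by (simp add: mult.assoc)
      show "AE x in lebesgue. indicat_real {a<..<b} x * (g x * \<phi> x) = g' x * \<phi> x"
        using ae by eventually_elim (simp flip: mult.assoc)
    qed (auto intro!: measurable_completion)
    also have "\<dots> = (LINT x|lborel. g' x * \<phi> x)"
      by (rule integral_completion) measurable
    finally show ?thesis .
  qed
  then show thesis using 1 2 3 that by blast
qed

text \<open>The fundamental lemma of the calculus of variations: the indicator function of an open interval is a
  bounded pointwise limit of test functions, so \<open>g\<close> has integral zero over every interval.\<close>

lemma AE_zero_of_test_fun:
  fixes g :: "real \<Rightarrow> real"
  assumes ab: "a < b" and g: "integrable (lebesgue_on {a<..<b}) g"
    and z: "\<And>\<phi>. test_fun a b \<phi> \<Longrightarrow> (LINT x|lebesgue_on {a<..<b}. g x * \<phi> x) = 0"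
  shows "AE x in lebesgue_on {a<..<b}. g x = 0"
proof -
  obtain g' where g': "integrable lborel g'" "\<And>x. x \<notin> {a<..<b} \<Longrightarrow> g' x = 0"
    "AE x in lebesgue_on {a<..<b}. g' x = g x"
    "\<And>\<phi>. \<phi> \<in> borel_measurable borel \<Longrightarrow> (LINT x|lebesgue_on {a<..<b}. g x * \<phi> x) = (LINT x|lborel. g' x * \<phi> x)"
    using borel_representative[OF g] by blast
  have "(LINT x:{c0<..<d0}|lborel. g' x) = 0" for c0 d0
  proof -
    define c d where "c = max a c0" and "d = min b d0"
    \<comment> \<open>The shift by \<open>1\<close> keeps the support of \<open>\<phi> k\<close> inside \<open>[c + 1/(k+1), d - 1/(k+1)]\<close>, away from
      the endpoints of \<open>(a, b)\<close>. As \<open>k\<close> grows, each factor tends to \<open>1\<close> where its argument is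
      eventually positive.\<close>
    define \<phi> where "\<phi> k x = flat 1 (real (Suc k) * (x - c) - 1) * flat 1 (real (Suc k) * (d - x) - 1)" for k :: nat and x
    have \<phi>eq: "\<phi> k x = flat 1 (real (Suc k) * x + (- real (Suc k) * c - 1)) *
        flat 1 (- real (Suc k) * x + (real (Suc k) * d - 1))" for k x
      by (simp add: \<phi>_def algebra_simps)
    have sm: "smooth (\<phi> k)" for k
      unfolding \<phi>eq[abs_def] by (intro smooth_mult smooth_affine[OF smooth_flat])
    have tf: "test_fun a b (\<phi> k)" for k
    proof (rule test_funI[OF sm])
      have "a \<le> c" "d \<le> b" "0 < 1 / real (Suc k)" by (auto simp: c_def d_def)
      then show "a < c + 1 / real (Suc k)" "d - 1 / real (Suc k) < b" by linarith+
      show "\<phi> k x = 0" if "x \<notin> {c + 1 / real (Suc k)..d - 1 / real (Suc k)}" for x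
        using that by (auto simp: \<phi>_def flat_def field_simps)
    qed
    have zero: "(LINT x|lborel. g' x * \<phi> k x) = 0" for k
      using z[OF tf] g'(4)[OF smooth_borel[OF sm]] by simp
    have lim1: "(\<lambda>k. flat 1 (real (Suc k) * y - 1)) \<longlonglongrightarrow> (if y > 0 then 1 else 0)" for y
    proof (cases "y > 0")
      case True
      have "LIM k sequentially. - 1 + y * real (Suc k) :> at_top"
        by (intro filterlim_tendsto_add_at_top[OF tendsto_const]
            filterlim_tendsto_pos_mult_at_top[OF tendsto_const True]
            filterlim_compose[OF filterlim_real_sequentially filterlim_Suc])
      then have "LIM k sequentially. real (Suc k) * y - 1 :> at_top"
        by (simp add: algebra_simps)
      moreover have "((\<lambda>u::real. exp (- (1 / u))) \<longlongrightarrow> 1) at_top"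
        using tendsto_exp[OF tendsto_minus[OF tendsto_inverse_0_at_top[OF filterlim_ident]]]
        by (simp add: divide_inverse)
      moreover have "\<forall>\<^sub>F u in at_top. exp (- (1 / u)) = flat 1 u"
        using eventually_gt_at_top[of 0] by eventually_elim (simp add: flat_def)
      ultimately have "(\<lambda>k. flat 1 (real (Suc k) * y - 1)) \<longlonglongrightarrow> 1"
        using filterlim_compose Lim_transform_eventually by blast
      then show ?thesis using True by simp
    next
      case False
      then have "flat 1 (real (Suc k) * y - 1) = 0" for k
        using mult_nonneg_nonpos[of "real (Suc k)" y] by (simp add: flat_def)
      then show ?thesis using False by simp
    qed
    have lim: "(\<lambda>k. g' x * \<phi> k x) \<longlonglongrightarrow> indicator {c0<..<d0} x *\<^sub>R g' x" for x
    proof -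
      have "(\<lambda>k. g' x * \<phi> k x) \<longlonglongrightarrow> g' x * ((if x - c > 0 then 1 else 0) * (if d - x > 0 then 1 else 0))"
        unfolding \<phi>_def by (intro tendsto_intros lim1)
      moreover have "g' x * ((if x - c > 0 then 1 else 0) * (if d - x > 0 then 1 else 0)) = indicator {c0<..<d0} x *\<^sub>R g' x"
        using g'(2)[of x] by (auto simp: c_def d_def)
      ultimately show ?thesis by (simp only:)
    qed
    have "(\<lambda>k. LINT x|lborel. g' x * \<phi> k x) \<longlonglongrightarrow> (LINT x|lborel. indicator {c0<..<d0} x *\<^sub>R g' x)"
    proof (rule integral_dominated_convergence[of _ _ _ "\<lambda>x. \<bar>g' x\<bar>"])
      have g'm[measurable]: "g' \<in> borel_measurable borel" using g'(1) by auto
      show "(\<lambda>x. indicator {c0<..<d0} x *\<^sub>R g' x) \<in> borel_measurable lborel" by measurable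
      have [measurable]: "\<phi> k \<in> borel_measurable borel" for k using sm smooth_borel by blast
      show "(\<lambda>x. g' x * \<phi> k x) \<in> borel_measurable lborel" for k by measurable
      show "integrable lborel (\<lambda>x. \<bar>g' x\<bar>)" using g' by auto
      show "AE x in lborel. (\<lambda>k. g' x * \<phi> k x) \<longlonglongrightarrow> indicator {c0<..<d0} x *\<^sub>R g' x" using lim by simp
      have fl: "0 \<le> flat 1 u" "flat 1 u \<le> 1" for u by (auto simp: flat_def)
      have "\<bar>\<phi> k x\<bar> \<le> 1" for k x
        unfolding \<phi>_def abs_mult using fl by (intro mult_le_one) auto
      then show "AE x in lborel. norm (g' x * \<phi> k x) \<le> \<bar>g' x\<bar>" for k
        by (auto simp: abs_mult intro!: mult_left_le)
    qed
    then show ?thesis using zero by (simp add: set_lebesgue_integral_def LIMSEQ_const_iff)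
  qed
  then have "AE x in lborel. g' x = 0"
    using AE_zero_of_intervals[OF g'(1,2)] by blast
  then have "AE x in lebesgue_on {a<..<b}. g' x = 0"
    using AE_completion by (subst AE_restrict_space_iff) fastforce+
  with g'(3) show ?thesis by eventually_elim simp
qed

lemma indefinite_integral_lborel:
  fixes A :: "real \<Rightarrow> real"
  assumes g': "integrable lborel g'" "\<And>x. x \<notin> {a<..<b} \<Longrightarrow> g' x = 0"
    "AE x in lebesgue_on {a<..<b}. g' x = A x" and t: "t \<le> b"
  shows "integral {a..t} A = (LINT s|lborel. g' s * indicator {..t} s)"
proof -
  have "integrable lborel (\<lambda>s. g' s * indicator {..t} s)"
    using integrable_mult_indicator[of "{..t}" lborel g'] g'(1) by (simp add: mult.commute)
  then have "(LINT s|lborel. g' s * indicator {..t} s) = integral UNIV (\<lambda>s. g' s * indicator {..t} s)"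
    by (rule integral_lborel[symmetric])
  also have "\<dots> = integral UNIV (\<lambda>s. if s \<in> {a..t} then g' s else 0)"
    using g'(2) by (intro arg_cong[of _ _ "integral UNIV"]) (auto simp: fun_eq_iff indicator_def)
  also have "\<dots> = integral {a..t} g'" by (rule integral_restrict_UNIV)
  also have "\<dots> = integral {a..t} A" by (rule integral_cong_AE_interval[OF g'(3) t])
  finally show ?thesis by (rule sym)
qed

text \<open>\<open>A\<close> is merely integrable, so its indefinite integral need not be differentiable everywhere and the
  product rule is not available. Instead, \<open>\<phi> s\<close> is written as minus the integral of \<open>deriv \<phi>\<close> over
  \<open>[s, \<infinity>)\<close>, and the order of integration over the region \<open>s \<le> t\<close> is exchanged.\<close>

lemma integration_by_parts_test_fun:
  fixes A :: "real \<Rightarrow> real"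
  assumes ab: "a < b" and A: "integrable (lebesgue_on {a<..<b}) A" and tf: "test_fun a b \<phi>"
  shows "(LINT x|lebesgue_on {a<..<b}. A x * \<phi> x) =
    - (LINT x|lebesgue_on {a<..<b}. integral {a..x} A * deriv \<phi> x)"
proof -
  define d where "d = deriv \<phi>"
  have tfd: "test_fun a b d" unfolding d_def by (rule test_fun_deriv[OF tf ab])
  note d0 = test_fun_outside[OF tfd ab]
  note sm = test_fun_smooth[OF tf] and smd = test_fun_smooth[OF tfd]
  obtain M where M: "\<And>x. \<bar>d x\<bar> \<le> M" using test_fun_bounded[OF tfd ab] by blast
  obtain g' where g': "integrable lborel g'" "\<And>x. x \<notin> {a<..<b} \<Longrightarrow> g' x = 0"
    "AE x in lebesgue_on {a<..<b}. g' x = A x"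
    "\<And>\<phi>. \<phi> \<in> borel_measurable borel \<Longrightarrow> (LINT x|lebesgue_on {a<..<b}. A x * \<phi> x) = (LINT x|lborel. g' x * \<phi> x)"
    using borel_representative[OF A] by blast
  have [measurable]: "g' \<in> borel_measurable borel" using g'(1) by auto
  have [measurable]: "d \<in> borel_measurable borel" using smooth_borel[OF smd] .
  have dint: "integrable lborel d"
  proof -
    have "integrable lborel (\<lambda>x. indicator {a..b} x *\<^sub>R d x)"
      by (rule borel_integrable_compact[OF compact_Icc smooth_continuous_on[OF smd]])
    moreover have "indicator {a..b} x *\<^sub>R d x = d x" for x
      using d0[of x] by (cases "x \<in> {a<..<b}") (auto simp: indicator_def)
    ultimately show ?thesis by (simp only:)
  qed
  define H where "H s t = g' s * (d t * (if s \<le> t then 1 else 0))" for s t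
  have Hm[measurable]: "case_prod H \<in> borel_measurable (lborel \<Otimes>\<^sub>M lborel)"
    unfolding H_def by measurable
  have inner: "integrable lborel (\<lambda>t. d t * (if s \<le> t then 1 else 0))" for s
    by (rule Bochner_Integration.integrable_bound[OF dint]) auto
  have Hint: "integrable (lborel \<Otimes>\<^sub>M lborel) (case_prod H)"
  proof (rule lborel_pair.Fubini_integrable[OF Hm])
    show "integrable lborel (\<lambda>x. LINT y|lborel. norm (case_prod H (x, y)))"
    proof (rule Bochner_Integration.integrable_bound)
      show "integrable lborel (\<lambda>x. g' x * (LINT t|lborel. \<bar>d t\<bar>))" using g'(1) by auto
      show "(\<lambda>x. LINT y|lborel. norm (case_prod H (x, y))) \<in> borel_measurable lborel" by measurable
      have "norm (LINT t|lborel. norm (case_prod H (s, t))) \<le> norm (g' s * (LINT t|lborel. \<bar>d t\<bar>))" for s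
      proof -
        have "(LINT t|lborel. norm (case_prod H (s, t))) = \<bar>g' s\<bar> * (LINT t|lborel. \<bar>d t * (if s \<le> t then 1 else 0)\<bar>)"
          by (simp add: H_def abs_mult)
        also have "\<dots> \<le> \<bar>g' s\<bar> * (LINT t|lborel. \<bar>d t\<bar>)"
          by (intro mult_left_mono integral_mono integrable_abs inner dint) auto
        finally have "(LINT t|lborel. norm (case_prod H (s, t))) \<le> \<bar>g' s\<bar> * (LINT t|lborel. \<bar>d t\<bar>)" .
        moreover have "0 \<le> (LINT t|lborel. norm (case_prod H (s, t)))" by simp
        ultimately show ?thesis by (simp add: abs_mult)
      qed
      then show "AE s in lborel. norm (LINT t|lborel. norm (case_prod H (s, t))) \<le> norm (g' s * (LINT t|lborel. \<bar>d t\<bar>))"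
        by simp
    qed
    show "AE x in lborel. integrable lborel (\<lambda>y. case_prod H (x, y))"
      using inner by (simp add: H_def)
  qed
  have in1: "(LINT t|lborel. H s t) = - (g' s * \<phi> s)" for s
  proof -
    define r where "r = max s b"
    have "(LINT t|lborel. d t * indicator {s..r} t) = \<phi> r - \<phi> s"
    proof (rule integral_FTC_Icc_real)
      show "(\<phi> has_real_derivative d x) (at x)" for x
        unfolding d_def by (rule smooth_has_deriv[OF sm])
      show "isCont d x" for x using smooth_has_deriv[OF smd] DERIV_isCont by blast
    qed (simp add: r_def)
    moreover have "\<phi> r = 0" using test_fun_outside[OF tf ab, of r] by (simp add: r_def)
    moreover have "d t * indicator {s..r} t = d t * (if s \<le> t then 1 else 0)" for t
      using d0[of t] by (cases "t \<in> {a<..<b}") (auto simp: r_def indicator_def)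
    ultimately have "(LINT t|lborel. d t * (if s \<le> t then 1 else 0)) = - \<phi> s" by simp
    then show ?thesis by (simp add: H_def)
  qed
  have in2: "(LINT s|lborel. H s t) = indicator {a<..<b} t *\<^sub>R (integral {a..t} A * d t)" for t
  proof (cases "t \<in> {a<..<b}")
    case True
    have "H s t = d t * (g' s * indicator {..t} s)" for s by (simp add: H_def indicator_def)
    then have "(LINT s|lborel. H s t) = d t * (LINT s|lborel. g' s * indicator {..t} s)" by simp
    then show ?thesis
      using True indefinite_integral_lborel[OF g'(1-3), of t] by simp
  next
    case False
    then show ?thesis using d0 by (simp add: H_def)
  qed
  have J: "(\<lambda>t. LINT s|lborel. H s t) \<in> borel_measurable lborel"
    using lborel_pair.integrable_snd[OF Hint] by (rule borel_measurable_integrable)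
  have "(LINT x|lebesgue_on {a<..<b}. A x * \<phi> x) = (LINT s|lborel. g' s * \<phi> s)"
    by (rule g'(4)[OF smooth_borel[OF sm]])
  also have "\<dots> = - (LINT s|lborel. LINT t|lborel. H s t)" by (simp add: in1)
  also have "(LINT s|lborel. LINT t|lborel. H s t) = (LINT t|lborel. LINT s|lborel. H s t)"
    by (rule lborel_pair.Fubini_integral[OF Hint, symmetric])
  also have "\<dots> = (LINT t|lebesgue. LINT s|lborel. H s t)"
    by (rule integral_completion[OF J, symmetric])
  also have "\<dots> = (LINT x|lebesgue_on {a<..<b}. integral {a..x} A * d x)"
    unfolding in2 by (subst integral_restrict_space) auto
  finally show ?thesis by (simp add: d_def)
qed

section \<open>The du Bois-Reymond lemma\<close>

lemma test_fun_integrable: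
  assumes "test_fun a b \<phi>" "a < b"
  shows "integrable (lebesgue_on {a<..<b}) \<phi>"
proof -
  have "integrable (lebesgue_on {a..b}) \<phi>"
    by (rule continuous_imp_integrable_real[OF smooth_continuous_on[OF test_fun_smooth[OF assms(1)]]])
  then show ?thesis by (simp add: integrable_closed_interval_iff)
qed

text \<open>An antiderivative of \<open>\<psi>\<close> is constant on either side of the support of \<open>\<psi>\<close>. The integral
  condition says that the two constants agree, so subtracting one of them gives compact support.\<close>

lemma test_fun_antiderivative:
  assumes tf: "test_fun a b \<psi>" and ab: "a < b" and z: "(LINT x|lebesgue_on {a<..<b}. \<psi> x) = 0"
  obtains \<Psi> where "test_fun a b \<Psi>" "deriv \<Psi> = \<psi>"
proof -
  note sm = test_fun_smooth[OF tf]
  have "\<exists>F. \<forall>x::real. - \<infinity> < ereal x \<longrightarrow> ereal x < \<infinity> \<longrightarrow> (F has_vector_derivative \<psi> x) (at x)"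
    by (rule einterval_antiderivative) (auto intro: DERIV_isCont[OF smooth_has_deriv[OF sm]])
  then obtain F where F: "\<And>x. (F has_vector_derivative \<psi> x) (at x)" by auto
  define \<Psi> where "\<Psi> x = F x - F a" for x
  have D: "(\<Psi> has_real_derivative \<psi> x) (at x)" for x
    unfolding \<Psi>_def using F[of x] 
    by (auto intro!: derivative_eq_intros simp: has_real_derivative_iff_has_vector_derivative)
  then have dP: "deriv \<Psi> = \<psi>" by (intro ext DERIV_imp_deriv)
  have smP: "smooth \<Psi>"
    using D sm by (subst smooth_iff_deriv) (auto simp: dP real_differentiable_def)
  have FTC: "integral {x..y} \<psi> = F y - F x" if "x \<le> y" for x y
    by (intro integral_unique fundamental_theorem_of_calculus that has_vector_derivative_at_within[OF F])
  obtain c d where cd: "a < c" "c < d" "d < b" "\<And>x. x \<notin> {c..d} \<Longrightarrow> \<psi> x = 0"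
    using test_fun_support[OF tf ab] by blast
  have zero: "F y = F x" if "x \<le> y" "\<And>t. t \<in> {x..y} \<Longrightarrow> t \<notin> {c..d}" for x y
  proof -
    have "integral {x..y} \<psi> = integral {x..y} (\<lambda>x. 0)"
      by (rule Henstock_Kurzweil_Integration.integral_cong) (use that cd in auto)
    then show ?thesis using FTC[OF that(1)] by simp
  qed
  have "(LINT x|lebesgue_on {a<..<b}. \<psi> x) = integral {a..b} \<psi>"
    using lebesgue_integral_eq_integral[OF test_fun_integrable[OF tf ab]]
    by (simp add: integral_open_interval_real)
  then have Fb: "F b = F a" using FTC[of a b] ab z by simp
  have "\<Psi> x = 0" if x: "x \<notin> {c..d}" for x
  proof -
    consider "x < c" | "d < x" using x by fastforce
    then show ?thesis
    proof cases
      case 1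
      then have "F (max a x) = F (min a x)" using cd by (intro zero) auto
      then show ?thesis by (auto simp: \<Psi>_def max_def min_def split: if_splits)
    next
      case 2
      then have "F (max b x) = F (min b x)" using cd by (intro zero) auto
      then show ?thesis using Fb by (auto simp: \<Psi>_def max_def min_def split: if_splits)
    qed
  qed
  then have "test_fun a b \<Psi>" using smP cd by (intro test_funI[of _ a c d b]) auto
  then show thesis using dP that by blast
qed

text \<open>Otherwise the constant \<open>1\<close> would vanish almost everywhere.\<close>

lemma test_fun_integral_nonzero:
  assumes "a < b"
  shows "\<exists>\<eta>. test_fun a b \<eta> \<and> (LINT x|lebesgue_on {a<..<b}. \<eta> x) \<noteq> 0"
proof (rule ccontr)
  assume "\<not> ?thesis"
  then have *: "(LINT x|lebesgue_on {a<..<b}. 1 * \<eta> x) = 0" if "test_fun a b \<eta>" for \<eta>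
    using that by auto
  have "integrable (lebesgue_on {a<..<b}) (\<lambda>x. 1::real)"
    using continuous_imp_integrable_real[of a b "\<lambda>x. 1::real"]
    by (simp only: integrable_closed_interval_iff(1) continuous_on_const)
  from AE_zero_of_test_fun[OF assms this *] have "negligible {a<..<b}"
    by (simp add: AE_interval_iff_negligible greaterThanLessThan_def greaterThan_def lessThan_def Int_def)
  then show False using assms negligible_interval(2)[of a b] by (simp add: box_real)
qed

text \<open>The derivatives of test functions are exactly the test functions with integral zero, that is, the
  kernel of one linear functional. A functional that annihilates this kernel is a multiple of it.\<close>

lemma derivative_annihilator:
  assumes ab: "a < b"
    and lin: "\<And>\<phi> \<psi> c. test_fun a b \<phi> \<Longrightarrow> test_fun a b \<psi> \<Longrightarrow> L (\<lambda>x. \<phi> x + c * \<psi> x) = L \<phi> + c * L \<psi>"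
    and der: "\<And>\<phi>. test_fun a b \<phi> \<Longrightarrow> L (deriv \<phi>) = (0::real)"
  obtains K where "\<And>\<phi>. test_fun a b \<phi> \<Longrightarrow> L \<phi> = K * (LINT x|lebesgue_on {a<..<b}. \<phi> x)"
proof -
  obtain \<eta> where \<eta>: "test_fun a b \<eta>" "(LINT x|lebesgue_on {a<..<b}. \<eta> x) \<noteq> 0"
    using test_fun_integral_nonzero[OF ab] by blast
  have "L \<phi> = L \<eta> / (LINT x|lebesgue_on {a<..<b}. \<eta> x) * (LINT x|lebesgue_on {a<..<b}. \<phi> x)"
    if \<phi>: "test_fun a b \<phi>" for \<phi>
  proof -
    \<comment> \<open>Chosen such that \<open>\<phi> + c \<eta>\<close> has integral zero.\<close>
    define c where "c = - ((LINT x|lebesgue_on {a<..<b}. \<phi> x) / (LINT x|lebesgue_on {a<..<b}. \<eta> x))"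
    have tf: "test_fun a b (\<lambda>x. \<phi> x + c * \<eta> x)"
      by (intro test_fun_add test_fun_scale \<phi> \<eta>)
    have "(LINT x|lebesgue_on {a<..<b}. \<phi> x + c * \<eta> x) = 0"
      using \<eta>(2) test_fun_integrable[OF \<phi> ab] test_fun_integrable[OF \<eta>(1) ab] by (simp add: c_def)
    then obtain \<Psi> where "test_fun a b \<Psi>" "deriv \<Psi> = (\<lambda>x. \<phi> x + c * \<eta> x)"
      using test_fun_antiderivative[OF tf ab] by blast
    then have "L (\<lambda>x. \<phi> x + c * \<eta> x) = 0" using der by metis
    then show ?thesis using lin[OF \<phi> \<eta>(1), of c] by (simp add: c_def)
  qed
  then show thesis by (rule that)
qed

lemma indefinite_integral_continuous:
  fixes A :: "real \<Rightarrow> real"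
  assumes "integrable (lebesgue_on {a<..<b}) A"
  shows "continuous_on {a..b} (\<lambda>t. integral {a..t} A)"
  using assms
  by (intro indefinite_integral_continuous_1 integrable_on_lebesgue_on)
    (auto simp: integrable_closed_interval_iff)

lemma continuous_imp_integrable_open:
  fixes A :: "real \<Rightarrow> real"
  assumes "continuous_on {a..b} A"
  shows "integrable (lebesgue_on {a<..<b}) A"
  using continuous_imp_integrable_real[OF assms] by (simp add: integrable_closed_interval_iff)

text \<open>The term of order zero, \<open>(A 0 - e) \<phi>\<close>, becomes a term in \<open>deriv \<phi>\<close> by parts. The remaining identity
  involves \<open>\<phi>\<close> only through \<open>deriv \<phi>\<close>, so by \<open>derivative_annihilator\<close> it extends to all test functions
  at the price of a constant. This is an identity of order \<open>n - 1\<close> for the coefficients \<open>A 1, \<dots>, A n\<close>,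
  with \<open>e\<close> replaced by \<open>K + \<integral>\<^sub>a\<^sup>t (A 0 - e)\<close>. The function \<open>e\<close> is a parameter to make this induction
  possible.\<close>

lemma du_bois_reymond_chain:
  fixes A :: "nat \<Rightarrow> real \<Rightarrow> real"
  assumes ab: "a < b" and "integrable (lebesgue_on {a<..<b}) e"
    and "\<And>i. i \<le> n \<Longrightarrow> integrable (lebesgue_on {a<..<b}) (A i)"
    and "\<And>\<phi>. test_fun a b \<phi> \<Longrightarrow>
      (LINT x|lebesgue_on {a<..<b}. (A 0 x - e x) * \<phi> x + (\<Sum>i<n. A (Suc i) x * (deriv ^^ Suc i) \<phi> x)) = 0"
  shows "\<exists>E. E 0 = e \<and> (\<forall>j<n. \<exists>K. \<forall>t. E (Suc j) t = K + integral {a..t} (\<lambda>s. A j s - E j s)) \<and>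
           (AE x in lebesgue_on {a<..<b}. A n x = E n x)"
  using assms(2-)
proof (induction n arbitrary: A e)
  case 0
  have "AE x in lebesgue_on {a<..<b}. A 0 x - e x = 0"
    by (rule AE_zero_of_test_fun[OF ab]) (use 0 in auto)
  then show ?case by (intro exI[of _ "\<lambda>_. e"]) simp
next
  case (Suc n)
  let ?M = "lebesgue_on {a<..<b}"
  define IB where "IB t = integral {a..t} (\<lambda>s. A 0 s - e s)" for t
  have B: "integrable ?M (\<lambda>s. A 0 s - e s)" using Suc.prems by simp
  have IBc: "continuous_on {a..b} IB" unfolding IB_def by (rule indefinite_integral_continuous[OF B])
  have IBi: "integrable ?M IB" by (rule continuous_imp_integrable_open[OF IBc])
  have summand: "integrable ?M (\<lambda>x. A i x * (deriv ^^ k) \<phi> x)" if "i \<le> Suc n" "test_fun a b \<phi>" for i k \<phi>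
    using that by (intro integrable_times_test_fun ab test_fun_higher_deriv Suc.prems)
  define T where "T \<phi> x = (A 1 x - IB x) * \<phi> x + (\<Sum>i<n. A (Suc (Suc i)) x * (deriv ^^ Suc i) \<phi> x)" for \<phi> x
  have Ti: "integrable ?M (T \<phi>)" if "test_fun a b \<phi>" for \<phi>
    unfolding T_def using that IBi Suc.prems
    by (intro Bochner_Integration.integrable_add Bochner_Integration.integrable_sum summand integrable_times_test_fun ab) auto
  \<comment> \<open>\<open>L (deriv \<phi>)\<close> is the integral in the hypothesis after the integration by parts.\<close>
  define L where "L \<phi> = (LINT x|?M. T \<phi> x)" for \<phi>
  obtain K where K: "\<And>\<phi>. test_fun a b \<phi> \<Longrightarrow> L \<phi> = K * (LINT x|?M. \<phi> x)"
  proof (rule derivative_annihilator[OF ab, of L])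
    fix \<phi> \<psi> c assume tf: "test_fun a b \<phi>" "test_fun a b \<psi>"
    have "(deriv ^^ Suc i) (\<lambda>x. \<phi> x + c * \<psi> x) x = (deriv ^^ Suc i) \<phi> x + c * (deriv ^^ Suc i) \<psi> x" for i x
      unfolding deriv_add[OF test_fun_smooth[OF tf(1)] test_fun_smooth[OF test_fun_scale[OF tf(2)]]]
        deriv_scale[OF test_fun_smooth[OF tf(2)]] ..
    then have Tlin: "T (\<lambda>x. \<phi> x + c * \<psi> x) = (\<lambda>x. T \<phi> x + c * T \<psi> x)"
      unfolding T_def fun_eq_iff by (simp only:) (simp add: algebra_simps sum.distrib sum_distrib_left)
    then show "L (\<lambda>x. \<phi> x + c * \<psi> x) = L \<phi> + c * L \<psi>"
      unfolding L_def Tlin using Ti[OF tf(1)] Ti[OF tf(2)] by simp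
  next
    fix \<phi> assume tf: "test_fun a b \<phi>"
    have tfd: "test_fun a b (deriv \<phi>)" by (rule test_fun_deriv[OF tf ab])
    have 1: "integrable ?M (\<lambda>x. (A 0 x - e x) * \<phi> x)" by (rule integrable_times_test_fun[OF tf ab B])
    have 2: "integrable ?M (\<lambda>x. IB x * deriv \<phi> x)" by (rule integrable_times_test_fun[OF tfd ab IBi])
    have eq: "(A 0 x - e x) * \<phi> x + (\<Sum>i<Suc n. A (Suc i) x * (deriv ^^ Suc i) \<phi> x) =
       (A 0 x - e x) * \<phi> x + IB x * deriv \<phi> x + T (deriv \<phi>) x" for x
    proof -
      have "(deriv ^^ Suc i) (deriv \<phi>) = (deriv ^^ Suc (Suc i)) \<phi>" for i
        by (simp only: funpow_Suc_right o_def)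
      then show ?thesis
        unfolding T_def sum.lessThan_Suc_shift by (simp add: algebra_simps)
    qed
    have "0 = (LINT x|?M. (A 0 x - e x) * \<phi> x + IB x * deriv \<phi> x + T (deriv \<phi>) x)"
      using Suc.prems(3)[OF tf] unfolding eq by simp
    also have "\<dots> = (LINT x|?M. (A 0 x - e x) * \<phi> x) + (LINT x|?M. IB x * deriv \<phi> x) + L (deriv \<phi>)"
      unfolding L_def using 1 2 Ti[OF tfd] by simp
    also have "\<dots> = L (deriv \<phi>)"
      using integration_by_parts_test_fun[OF ab B tf] unfolding IB_def by simp
    finally show "L (deriv \<phi>) = 0" by simp
  qed (rule that)
  define e' where "e' t = K + IB t" for t
  have "\<exists>E. E 0 = e' \<and> (\<forall>j<n. \<exists>K. \<forall>t. E (Suc j) t = K + integral {a..t} (\<lambda>s. A (Suc j) s - E j s)) \<and>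
           (AE x in ?M. A (Suc n) x = E n x)"
  proof (rule Suc.IH)
    show "integrable ?M e'"
      unfolding e'_def by (intro continuous_imp_integrable_open continuous_intros IBc)
    show "integrable ?M (A (Suc i))" if "i \<le> n" for i using that Suc.prems by auto
    fix \<phi> assume tf: "test_fun a b \<phi>"
    have "(A (Suc 0) x - e' x) * \<phi> x + (\<Sum>i<n. A (Suc (Suc i)) x * (deriv ^^ Suc i) \<phi> x) = T \<phi> x - K * \<phi> x" for x
      by (simp add: T_def e'_def algebra_simps)
    then show "(LINT x|?M. (A (Suc 0) x - e' x) * \<phi> x + (\<Sum>i<n. A (Suc (Suc i)) x * (deriv ^^ Suc i) \<phi> x)) = 0"
      using K[OF tf] Ti[OF tf] test_fun_integrable[OF tf ab] unfolding L_def by simp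
  qed
  then obtain E where E: "E 0 = e'" "AE x in ?M. A (Suc n) x = E n x"
    "\<And>j. j < n \<Longrightarrow> \<exists>K. \<forall>t. E (Suc j) t = K + integral {a..t} (\<lambda>s. A (Suc j) s - E j s)" by blast
  show ?case
  proof (intro exI[of _ "case_nat e E"] conjI allI impI)
    fix j assume "j < Suc n"
    show "\<exists>K. \<forall>t. (case Suc j of 0 \<Rightarrow> e | Suc x \<Rightarrow> E x) t = K + integral {a..t} (\<lambda>s. A j s - (case j of 0 \<Rightarrow> e | Suc x \<Rightarrow> E x) s)"
    proof (cases j)
      case 0
      then show ?thesis using E(1) by (auto simp: e'_def IB_def)
    next
      case (Suc i)
      then show ?thesis using E(3)[of i] \<open>j < Suc n\<close> by simp
    qed
  qed (use E in simp_all)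
qed

text \<open>A function with an integrable weak derivative \<open>v\<close> is an indefinite integral of \<open>v\<close>: this is the chain
  of length one for \<open>A 0 = v\<close> and \<open>A 1 = u\<close>.\<close>

lemma weak_primitive:
  fixes u v :: "real \<Rightarrow> real"
  assumes ab: "a < b" and u: "integrable (lebesgue_on {a<..<b}) u" and v: "integrable (lebesgue_on {a<..<b}) v"
    and weak: "\<And>\<phi>. test_fun a b \<phi> \<Longrightarrow>
      (LINT x|lebesgue_on {a<..<b}. u x * deriv \<phi> x) = - (LINT x|lebesgue_on {a<..<b}. v x * \<phi> x)"
  obtains K where "AE x in lebesgue_on {a<..<b}. u x = K + integral {a..x} v"
proof -
  define A where "A i = (if i = 0 then v else u)" for i :: nat
  have "\<exists>E. E 0 = (\<lambda>_. 0) \<and> (\<forall>j<1. \<exists>K. \<forall>t. E (Suc j) t = K + integral {a..t} (\<lambda>s. A j s - E j s)) \<and>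
           (AE x in lebesgue_on {a<..<b}. A 1 x = E 1 x)"
  proof (rule du_bois_reymond_chain[OF ab])
    fix \<phi> assume tf: "test_fun a b \<phi>"
    show "(LINT x|lebesgue_on {a<..<b}. (A 0 x - 0) * \<phi> x + (\<Sum>i<1. A (Suc i) x * (deriv ^^ Suc i) \<phi> x)) = 0"
      using weak[OF tf] integrable_times_test_fun[OF tf ab v] integrable_times_test_fun[OF test_fun_deriv[OF tf ab] ab u]
      by (simp add: A_def)
  qed (use u v in \<open>auto simp: A_def\<close>)
  then obtain E K where "E 0 = (\<lambda>_. 0)" "\<forall>t. E (Suc 0) t = K + integral {a..t} (\<lambda>s. A 0 s - E 0 s)"
    "AE x in lebesgue_on {a<..<b}. A 1 x = E 1 x" by auto
  then show thesis using that[of K] by (simp add: A_def)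
qed

section \<open>Sobolev functions and their perturbation by test functions\<close>

lemma L2_measurable: "u \<in> L2 a b \<Longrightarrow> u \<in> borel_measurable (lebesgue_on {a<..<b})"
  and L2_square_integrable: "u \<in> L2 a b \<Longrightarrow> integrable (lebesgue_on {a<..<b}) (\<lambda>x. (u x)\<^sup>2)"
  by (auto simp: L2_def)

lemma L2_integrable:
  assumes "u \<in> L2 a b"
  shows "integrable (lebesgue_on {a<..<b}) u"
proof (rule Bochner_Integration.integrable_bound)
  show "integrable (lebesgue_on {a<..<b}) (\<lambda>x. 1 + (u x)\<^sup>2)"
    using continuous_imp_integrable_open[of a b "\<lambda>x. 1"] L2_square_integrable[OF assms] by auto
  have "\<bar>y\<bar> \<le> 1 + y\<^sup>2" for y :: real
    using zero_le_power2[of "\<bar>y\<bar> - 1"] zero_le_power2[of y] by (simp add: power2_diff)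
  then show "AE x in lebesgue_on {a<..<b}. norm (u x) \<le> norm (1 + (u x)\<^sup>2)"
    by (auto intro: order_trans)
qed (rule L2_measurable[OF assms])

lemma L2_scale: "u \<in> L2 a b \<Longrightarrow> (\<lambda>x. c * u x) \<in> L2 a b"
  by (auto simp: L2_def power_mult_distrib)

lemma L2_add:
  assumes "u \<in> L2 a b" "v \<in> L2 a b"
  shows "(\<lambda>x. u x + v x) \<in> L2 a b"
proof -
  note [measurable] = assms[THEN L2_measurable]
  have "integrable (lebesgue_on {a<..<b}) (\<lambda>x. (u x + v x)\<^sup>2)"
  proof (rule Bochner_Integration.integrable_bound)
    show "integrable (lebesgue_on {a<..<b}) (\<lambda>x. 2 * (u x)\<^sup>2 + 2 * (v x)\<^sup>2)"
      using assms by (auto simp: L2_def)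
    have "(y + z)\<^sup>2 \<le> 2 * y\<^sup>2 + 2 * z\<^sup>2" for y z :: real
      using zero_le_power2[of "y - z"] by (simp add: power2_diff power2_sum)
    then show "AE x in lebesgue_on {a<..<b}. norm ((u x + v x)\<^sup>2) \<le> norm (2 * (u x)\<^sup>2 + 2 * (v x)\<^sup>2)"
      by simp
  qed simp
  then show ?thesis by (simp add: L2_def)
qed

lemma continuous_in_L2:
  assumes "continuous_on {a..b} u"
  shows "u \<in> L2 a b"
  using continuous_imp_integrable_open[OF assms]
    continuous_imp_integrable_open[of a b "\<lambda>x. (u x)\<^sup>2"] assms
  by (auto simp: L2_def intro!: continuous_intros)

lemma test_fun_in_L2: "test_fun a b \<phi> \<Longrightarrow> \<phi> \<in> L2 a b"
  by (intro continuous_in_L2 smooth_continuous_on test_fun_smooth)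

lemma weak_deriv_unique:
  assumes ab: "a < b" and v: "has_L2_weak_deriv a b i u v" "has_L2_weak_deriv a b i u v'"
  shows "AE x in lebesgue_on {a<..<b}. v x = v' x"
proof -
  have i: "integrable (lebesgue_on {a<..<b}) v" "integrable (lebesgue_on {a<..<b}) v'"
    using v by (auto simp: has_L2_weak_deriv_def intro: L2_integrable)
  have "AE x in lebesgue_on {a<..<b}. v x - v' x = 0"
  proof (rule AE_zero_of_test_fun[OF ab])
    show "integrable (lebesgue_on {a<..<b}) (\<lambda>x. v x - v' x)" using i by simp
    fix \<phi> assume tf: "test_fun a b \<phi>"
    have "(-1) ^ i * (LINT x|lebesgue_on {a<..<b}. v x * \<phi> x) = (-1) ^ i * (LINT x|lebesgue_on {a<..<b}. v' x * \<phi> x)"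
      using v tf by (simp add: has_L2_weak_deriv_def)
    then have "(LINT x|lebesgue_on {a<..<b}. v x * \<phi> x) = (LINT x|lebesgue_on {a<..<b}. v' x * \<phi> x)"
      by simp
    then show "(LINT x|lebesgue_on {a<..<b}. (v x - v' x) * \<phi> x) = 0"
      using i integrable_times_test_fun[OF tf ab] by (simp add: left_diff_distrib)
  qed
  then show ?thesis by eventually_elim simp
qed

text \<open>By parts with \<open>A = deriv \<phi>\<close>, whose indefinite integral from \<open>a\<close> is \<open>\<phi>\<close> again.\<close>

lemma integration_by_parts_test_funs:
  assumes ab: "a < b" and tf: "test_fun a b \<phi>" "test_fun a b \<psi>"
  shows "(LINT x|lebesgue_on {a<..<b}. \<phi> x * deriv \<psi> x) = - (LINT x|lebesgue_on {a<..<b}. deriv \<phi> x * \<psi> x)"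
proof -
  have "integral {a..x} (deriv \<phi>) = \<phi> x" if "x \<in> {a<..<b}" for x
  proof -
    have "integral {a..x} (deriv \<phi>) = \<phi> x - \<phi> a"
      using that smooth_has_deriv[OF test_fun_smooth[OF tf(1)]]
      by (intro integral_unique fundamental_theorem_of_calculus)
        (auto simp: has_real_derivative_iff_has_vector_derivative[symmetric] intro: has_field_derivative_at_within)
    then show ?thesis using test_fun_outside[OF tf(1) ab, of a] by simp
  qed
  then have "(LINT x|lebesgue_on {a<..<b}. integral {a..x} (deriv \<phi>) * deriv \<psi> x) = (LINT x|lebesgue_on {a<..<b}. \<phi> x * deriv \<psi> x)"
    by (intro Bochner_Integration.integral_cong) auto
  then show ?thesis
    using integration_by_parts_test_fun[OF ab test_fun_integrable[OF test_fun_deriv[OF tf(1) ab] ab] tf(2)] by simp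
qed

lemma test_fun_has_weak_deriv:
  assumes ab: "a < b" and tf: "test_fun a b \<phi>"
  shows "has_L2_weak_deriv a b i \<phi> ((deriv ^^ i) \<phi>)"
proof -
  have "(LINT x|lebesgue_on {a<..<b}. \<phi> x * (deriv ^^ i) \<psi> x) =
        (-1) ^ i * (LINT x|lebesgue_on {a<..<b}. (deriv ^^ i) \<phi> x * \<psi> x)" if "test_fun a b \<psi>" for \<psi>
    using that
  proof (induction i arbitrary: \<psi>)
    case (Suc i)
    have "(deriv ^^ Suc i) \<psi> = (deriv ^^ i) (deriv \<psi>)" by (simp add: funpow_swap1)
    then have "(LINT x|lebesgue_on {a<..<b}. \<phi> x * (deriv ^^ Suc i) \<psi> x) =
        (-1) ^ i * (LINT x|lebesgue_on {a<..<b}. (deriv ^^ i) \<phi> x * deriv \<psi> x)"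
      using Suc.IH[OF test_fun_deriv[OF Suc.prems ab]] by simp
    then show ?case
      using integration_by_parts_test_funs[OF ab test_fun_higher_deriv[OF tf ab] Suc.prems] by simp
  qed simp
  then show ?thesis
    by (auto simp: has_L2_weak_deriv_def intro: test_fun_in_L2 tf test_fun_higher_deriv ab)
qed

lemma has_weak_deriv_perturb:
  assumes ab: "a < b" and u: "has_L2_weak_deriv a b i u v" and tf: "test_fun a b \<phi>"
  shows "has_L2_weak_deriv a b i (\<lambda>x. u x + s * \<phi> x) (\<lambda>x. v x + s * (deriv ^^ i) \<phi> x)"
proof -
  note w = test_fun_has_weak_deriv[OF ab tf, of i]
  have L: "u \<in> L2 a b" "v \<in> L2 a b" "\<phi> \<in> L2 a b" "(deriv ^^ i) \<phi> \<in> L2 a b"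
    using u w by (auto simp: has_L2_weak_deriv_def)
  show ?thesis
    unfolding has_L2_weak_deriv_def
  proof (intro conjI allI impI L2_add L2_scale L)
    fix \<psi> assume \<psi>: "test_fun a b \<psi>"
    note int = integrable_times_test_fun[OF test_fun_higher_deriv[OF \<psi> ab] ab L2_integrable]
      integrable_times_test_fun[OF \<psi> ab L2_integrable]
    have "(LINT x|lebesgue_on {a<..<b}. (u x + s * \<phi> x) * (deriv ^^ i) \<psi> x) =
       (LINT x|lebesgue_on {a<..<b}. u x * (deriv ^^ i) \<psi> x) + s * (LINT x|lebesgue_on {a<..<b}. \<phi> x * (deriv ^^ i) \<psi> x)"
      using int(1)[OF L(1)] int(1)[OF L(3)] by (simp add: distrib_right mult.assoc)
    also have "\<dots> = (-1) ^ i * (LINT x|lebesgue_on {a<..<b}. v x * \<psi> x) +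
        s * ((-1) ^ i * (LINT x|lebesgue_on {a<..<b}. (deriv ^^ i) \<phi> x * \<psi> x))"
      using u w \<psi> by (simp add: has_L2_weak_deriv_def)
    also have "\<dots> = (-1) ^ i * (LINT x|lebesgue_on {a<..<b}. (v x + s * (deriv ^^ i) \<phi> x) * \<psi> x)"
      using int(2)[OF L(2)] int(2)[OF L(4)] by (simp add: distrib_right distrib_left mult.assoc mult.left_commute)
    finally show "(LINT x|lebesgue_on {a<..<b}. (u x + s * \<phi> x) * (deriv ^^ i) \<psi> x) =
      (-1) ^ i * (LINT x|lebesgue_on {a<..<b}. (v x + s * (deriv ^^ i) \<phi> x) * \<psi> x)" .
  qed
qed

lemma has_weak_deriv_weak_deriv:
  "has_L2_weak_deriv a b i u v \<Longrightarrow> has_L2_weak_deriv a b i u (weak_deriv a b i u)"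
  unfolding weak_deriv_def by (rule someI[of "has_L2_weak_deriv a b i u"])

lemma sobolev_weak_deriv:
  "u \<in> sobolev n a b \<Longrightarrow> i \<le> n \<Longrightarrow> has_L2_weak_deriv a b i u (weak_deriv a b i u)"
  unfolding sobolev_def using has_weak_deriv_weak_deriv by blast

lemma sobolev_perturb:
  "a < b \<Longrightarrow> u \<in> sobolev n a b \<Longrightarrow> test_fun a b \<phi> \<Longrightarrow> (\<lambda>x. u x + s * \<phi> x) \<in> sobolev n a b"
  unfolding sobolev_def using has_weak_deriv_perturb by blast

lemma weak_deriv_perturb:
  assumes "a < b" "u \<in> sobolev n a b" "i \<le> n" "test_fun a b \<phi>"
  shows "AE x in lebesgue_on {a<..<b}. weak_deriv a b i (\<lambda>x. u x + s * \<phi> x) x = weak_deriv a b i u x + s * (deriv ^^ i) \<phi> x"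
  by (rule weak_deriv_unique[OF assms(1) sobolev_weak_deriv[OF sobolev_perturb[OF assms(1,2,4)] assms(3)]
        has_weak_deriv_perturb[OF assms(1) sobolev_weak_deriv[OF assms(2,3)] assms(4)]])

text \<open>The set in the open interval where the two functions differ is open and null, hence empty; the
  endpoints follow by continuity.\<close>

lemma continuous_AE_eq:
  fixes g g' :: "real \<Rightarrow> real"
  assumes ab: "a < b" and c: "continuous_on {a..b} g" "continuous_on {a..b} g'"
    and ae: "AE x in lebesgue_on {a<..<b}. g x = g' x" and t: "t \<in> {a..b}"
  shows "g t = g' t"
proof -
  define h where "h x = g x - g' x" for x
  have hc: "continuous_on {a..b} h" unfolding h_def by (intro continuous_intros c)
  have "{x \<in> {a<..<b}. \<not> g x = g' x} = {a<..<b} \<inter> h -` (- {0})" by (auto simp: h_def)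
  moreover have "open ({a<..<b} \<inter> h -` (- {0}))"
    by (rule continuous_open_preimage[OF continuous_on_subset[OF hc]]) auto
  ultimately have "{x \<in> {a<..<b}. \<not> g x = g' x} = {}"
    using ae open_not_negligible by (auto simp: AE_interval_iff_negligible)
  then have z: "\<And>x. x \<in> {a<..<b} \<Longrightarrow> h x = 0" by (auto simp: h_def)
  have "h t = 0"
    by (rule continuous_constant_on_closure[of "{a<..<b}" h]) (use z hc t ab in auto)
  then show ?thesis by (simp add: h_def)
qed

lemma cont_rep_eq:
  assumes ab: "a < b" and g: "continuous_on {a..b} g" "AE x in lebesgue_on {a<..<b}. g x = u x"
  shows "continuous_on {a..b} (cont_rep a b u)" "AE x in lebesgue_on {a<..<b}. cont_rep a b u x = u x"
    and "\<And>t. t \<in> {a..b} \<Longrightarrow> cont_rep a b u t = g t"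
proof -
  have *: "continuous_on {a..b} (cont_rep a b u) \<and> (AE x in lebesgue_on {a<..<b}. cont_rep a b u x = u x)"
    unfolding cont_rep_def by (rule someI[of _ g]) (use g in simp)
  then show 1: "continuous_on {a..b} (cont_rep a b u)" "AE x in lebesgue_on {a<..<b}. cont_rep a b u x = u x"
    by auto
  show "cont_rep a b u t = g t" if "t \<in> {a..b}" for t
    by (rule continuous_AE_eq[OF ab 1(1) g(1) _ that]) (use 1(2) g(2) in eventually_elim, simp)
qed

text \<open>Testing the definition of the weak derivative of order \<open>i\<close> against \<open>deriv \<phi>\<close>, and comparing with
  that of order \<open>i + 1\<close>, shows that consecutive weak derivatives are weak derivatives of each other.\<close>

lemma sobolev_primitive:
  assumes ab: "a < b" and u: "u \<in> sobolev n a b" and i: "i < n"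
  obtains K where "continuous_on {a..b} (\<lambda>x. K + integral {a..x} (weak_deriv a b (Suc i) u))"
    and "AE x in lebesgue_on {a<..<b}. K + integral {a..x} (weak_deriv a b (Suc i) u) = weak_deriv a b i u x"
proof -
  have w: "has_L2_weak_deriv a b i u (weak_deriv a b i u)" "has_L2_weak_deriv a b (Suc i) u (weak_deriv a b (Suc i) u)"
    using sobolev_weak_deriv[OF u] i by auto
  then have L: "weak_deriv a b i u \<in> L2 a b" "weak_deriv a b (Suc i) u \<in> L2 a b"
    by (auto simp: has_L2_weak_deriv_def)
  have weak: "(LINT x|lebesgue_on {a<..<b}. weak_deriv a b i u x * deriv \<phi> x) = - (LINT x|lebesgue_on {a<..<b}. weak_deriv a b (Suc i) u x * \<phi> x)"
    if tf: "test_fun a b \<phi>" for \<phi>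
  proof -
    have "(-1) ^ i * (LINT x|lebesgue_on {a<..<b}. weak_deriv a b i u x * deriv \<phi> x) = (LINT x|lebesgue_on {a<..<b}. u x * (deriv ^^ i) (deriv \<phi>) x)"
      using w(1) test_fun_deriv[OF tf ab] by (simp add: has_L2_weak_deriv_def)
    also have "(deriv ^^ i) (deriv \<phi>) = (deriv ^^ Suc i) \<phi>" by (simp add: funpow_swap1)
    also have "(LINT x|lebesgue_on {a<..<b}. u x * (deriv ^^ Suc i) \<phi> x) = (-1) ^ i * - (LINT x|lebesgue_on {a<..<b}. weak_deriv a b (Suc i) u x * \<phi> x)"
      using w(2) tf by (simp add: has_L2_weak_deriv_def del: funpow.simps)
    finally show ?thesis by (subst (asm) mult_left_cancel) simp_all
  qed
  obtain K where K: "AE x in lebesgue_on {a<..<b}. weak_deriv a b i u x = K + integral {a..x} (weak_deriv a b (Suc i) u)"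
    by (rule weak_primitive[OF ab L[THEN L2_integrable] weak])
  show thesis
  proof
    show "continuous_on {a..b} (\<lambda>x. K + integral {a..x} (weak_deriv a b (Suc i) u))"
      by (intro continuous_intros indefinite_integral_continuous L2_integrable L(2))
    show "AE x in lebesgue_on {a<..<b}. K + integral {a..x} (weak_deriv a b (Suc i) u) = weak_deriv a b i u x"
      using K by eventually_elim simp
  qed
qed

lemma sderiv_AE:
  assumes ab: "a < b" and u: "u \<in> sobolev n a b" and i: "i \<le> n"
  shows "AE x in lebesgue_on {a<..<b}. sderiv n a b i u x = weak_deriv a b i u x"
    and "i < n \<Longrightarrow> continuous_on {a..b} (sderiv n a b i u)"
proof -
  have *: "(AE x in lebesgue_on {a<..<b}. cont_rep a b (weak_deriv a b i u) x = weak_deriv a b i u x) \<and>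
       continuous_on {a..b} (cont_rep a b (weak_deriv a b i u))" if lt: "i < n"
  proof -
    obtain K where K: "continuous_on {a..b} (\<lambda>x. K + integral {a..x} (weak_deriv a b (Suc i) u))"
      "AE x in lebesgue_on {a<..<b}. K + integral {a..x} (weak_deriv a b (Suc i) u) = weak_deriv a b i u x"
      by (rule sobolev_primitive[OF ab u lt])
    then show ?thesis using cont_rep_eq[OF ab K] by simp
  qed
  then show "AE x in lebesgue_on {a<..<b}. sderiv n a b i u x = weak_deriv a b i u x"
    "i < n \<Longrightarrow> continuous_on {a..b} (sderiv n a b i u)"
    by (auto simp: sderiv_def)
qed

lemma sderiv_primitive:
  assumes ab: "a < b" and u: "u \<in> sobolev n a b" and i: "i < n"
  obtains K where "\<And>t. t \<in> {a..b} \<Longrightarrow> sderiv n a b i u t = K + integral {a..t} (sderiv n a b (Suc i) u)"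
proof -
  obtain K where K: "continuous_on {a..b} (\<lambda>x. K + integral {a..x} (weak_deriv a b (Suc i) u))"
    "AE x in lebesgue_on {a<..<b}. K + integral {a..x} (weak_deriv a b (Suc i) u) = weak_deriv a b i u x"
    by (rule sobolev_primitive[OF ab u i])
  have eq: "sderiv n a b i u t = K + integral {a..t} (weak_deriv a b (Suc i) u)" if "t \<in> {a..b}" for t
    using cont_rep_eq(3)[OF ab K that] i by (simp add: sderiv_def)
  have "integral {a..t} (sderiv n a b (Suc i) u) = integral {a..t} (weak_deriv a b (Suc i) u)" if "t \<in> {a..b}" for t
    using integral_cong_AE_interval[OF sderiv_AE(1)[OF ab u], of "Suc i" t] that i by auto
  then show thesis using eq that by metis
qed

lemma sderiv_perturb:
  assumes ab: "a < b" and u: "u \<in> sobolev n a b" and tf: "test_fun a b \<phi>" and i: "i < n" and t: "t \<in> {a..b}"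
  shows "sderiv n a b i (\<lambda>x. u x + s * \<phi> x) t = sderiv n a b i u t + s * (deriv ^^ i) \<phi> t"
proof (rule continuous_AE_eq[OF ab _ _ _ t])
  note u' = sobolev_perturb[OF ab u tf, of s]
  show "continuous_on {a..b} (sderiv n a b i (\<lambda>x. u x + s * \<phi> x))"
    using sderiv_AE(2)[OF ab u'] i by simp
  show "continuous_on {a..b} (\<lambda>t. sderiv n a b i u t + s * (deriv ^^ i) \<phi> t)"
    using sderiv_AE(2)[OF ab u _ i] i smooth_continuous_on[OF smooth_higher_deriv[OF test_fun_smooth[OF tf]]]
    by (intro continuous_intros) simp_all
  show "AE x in lebesgue_on {a<..<b}. sderiv n a b i (\<lambda>x. u x + s * \<phi> x) x = sderiv n a b i u x + s * (deriv ^^ i) \<phi> x"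
    using weak_deriv_perturb[OF ab u _ tf, of i s] sderiv_AE(1)[OF ab u, of i] sderiv_AE(1)[OF ab u', of i] i
    by (auto elim: eventually_elim2)
qed

lemma sderiv_perturb_AE:
  assumes ab: "a < b" and u: "u \<in> sobolev n a b" and tf: "test_fun a b \<phi>" and i: "i \<le> n"
  shows "AE x in lebesgue_on {a<..<b}. sderiv n a b i (\<lambda>x. u x + s * \<phi> x) x = sderiv n a b i u x + s * (deriv ^^ i) \<phi> x"
  using weak_deriv_perturb[OF ab u i tf, of s] sderiv_AE(1)[OF ab u i] sderiv_AE(1)[OF ab sobolev_perturb[OF ab u tf, of s] i]
  by eventually_elim simp

text \<open>All derivatives of \<open>\<phi>\<close> vanish at both endpoints. In the condition of order \<open>n\<close>, the function that
  witnesses it for \<open>u\<close> is shifted by \<open>s * (deriv ^^ n) \<phi>\<close>.\<close>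

lemma admissible_perturb:
  assumes ab: "a < b" and N: "N \<subseteq> {0..n}" "N' \<subseteq> {0..n}" and tf: "test_fun a b \<phi>"
    and u: "u \<in> admissible n a b N N' \<alpha> \<beta>"
  shows "(\<lambda>x. u x + s * \<phi> x) \<in> admissible n a b N N' \<alpha> \<beta>"
proof -
  have us: "u \<in> sobolev n a b" using u by (simp add: admissible_def)
  have "endpoint_cond n a b i (\<lambda>x. u x + s * \<phi> x) e c"
    if ec: "endpoint_cond n a b i u e c" and i: "i \<le> n" and e: "e \<in> {a, b}" for i e c
  proof -
    have z: "(deriv ^^ i) \<phi> e = 0"
      using test_fun_outside[OF test_fun_higher_deriv[OF tf ab] ab, of e] e by auto
    show ?thesis
    proof (cases "i < n")
      case True
      then show ?thesis
        using ec sderiv_perturb[OF ab us tf True, of e s] e ab z by (auto simp: endpoint_cond_def)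
    next
      case False
      then obtain g where g: "AE x in lebesgue_on {a<..<b}. g x = weak_deriv a b i u x"
        "continuous (at e within {a..b}) g" "g e = c"
        using ec by (auto simp: endpoint_cond_def)
      have "AE x in lebesgue_on {a<..<b}. g x + s * (deriv ^^ i) \<phi> x = weak_deriv a b i (\<lambda>x. u x + s * \<phi> x) x"
        using g(1) weak_deriv_perturb[OF ab us i tf, of s] by eventually_elim simp
      moreover have "continuous (at e within {a..b}) (\<lambda>x. g x + s * (deriv ^^ i) \<phi> x)"
        using smooth_continuous_on[OF smooth_higher_deriv[OF test_fun_smooth[OF tf]], of "{a..b}" i] e ab g(2)
        by (intro continuous_intros) (auto simp: continuous_on_eq_continuous_within)
      ultimately show ?thesis using False g(3) z by (auto simp: endpoint_cond_def)
    qed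
  qed
  then show ?thesis
    using u N sobolev_perturb[OF ab us tf] unfolding admissible_def by auto
qed

lemma sobolev_norm_test_fun:
  assumes ab: "a < b" and tf: "test_fun a b \<phi>"
  shows "sobolev_norm n a b (\<lambda>x. s * \<phi> x) = \<bar>s\<bar> * (\<Sum>i=0..n. L2_norm a b ((deriv ^^ i) \<phi>))"
proof -
  have "L2_norm a b (weak_deriv a b i (\<lambda>x. s * \<phi> x)) = \<bar>s\<bar> * L2_norm a b ((deriv ^^ i) \<phi>)" for i
  proof -
    have w: "has_L2_weak_deriv a b i (\<lambda>x. s * \<phi> x) (\<lambda>x. s * (deriv ^^ i) \<phi> x)"
      using test_fun_has_weak_deriv[OF ab test_fun_scale[OF tf, of s], of i]
      by (simp add: deriv_scale[OF test_fun_smooth[OF tf]])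
    note w' = has_weak_deriv_weak_deriv[OF w]
    have "(LINT x|lebesgue_on {a<..<b}. (weak_deriv a b i (\<lambda>x. s * \<phi> x) x)\<^sup>2) = (LINT x|lebesgue_on {a<..<b}. (s * (deriv ^^ i) \<phi> x)\<^sup>2)"
    proof (rule integral_cong_AE)
      show "AE x in lebesgue_on {a<..<b}. (weak_deriv a b i (\<lambda>x. s * \<phi> x) x)\<^sup>2 = (s * (deriv ^^ i) \<phi> x)\<^sup>2"
        using weak_deriv_unique[OF ab w' w] by eventually_elim simp
    qed (use w w' in \<open>auto simp: has_L2_weak_deriv_def intro: L2_square_integrable borel_measurable_integrable\<close>)
    then show ?thesis
      unfolding L2_norm_def by (simp add: power_mult_distrib real_sqrt_mult)
  qed
  then show ?thesis unfolding sobolev_norm_def by (simp add: sum_distrib_left)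
qed

section \<open>The first variation\<close>

lemma pderivative_continuous:
  assumes "cont_second_partials (dom_f n a b) {1..n+2} f" "i \<in> {1..n+2}"
  shows "continuous_on (dom_f n a b) (pderivative (dom_f n a b) i f)"
  by (rule continuous_on_partials[OF coord_box_dom_f])
    (use assms in \<open>auto simp: cont_second_partials_def\<close>)

lemma continuous_of_cont_second_partials:
  assumes "cont_second_partials (dom_f n a b) {1..n+2} f"
  shows "continuous_on (dom_f n a b) f"
  by (rule continuous_on_partials[OF coord_box_dom_f _ pderivative_continuous[OF assms]])
    (use assms in \<open>auto simp: cont_second_partials_def\<close>)

lemma point_in_dom_f: "t \<in> {a..b} \<Longrightarrow> point n t y \<in> dom_f n a b"
  by (auto simp: point_def dom_f_def)

lemma point_apply: "point n t y 1 = t" "i \<le> n \<Longrightarrow> point n t y (i + 2) = y i"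
  by (auto simp: point_def)

lemma point_cong: "(\<And>i. i \<le> n \<Longrightarrow> y i = z i) \<Longrightarrow> point n t y = point n t z"
  by (auto simp: point_def fun_eq_iff)

lemma sum_shift_2: "(\<Sum>k=2..n+2. g k) = (\<Sum>i\<le>n. g (i + 2))" for g :: "nat \<Rightarrow> real"
  by (rule sum.reindex_bij_witness[of _ "\<lambda>i. i + 2" "\<lambda>k. k - 2"]) (auto simp: le_add_diff_inverse2 simp del: add_2_eq_Suc')

lemma sum_shift_1: "(\<Sum>k\<in>{1..n+2}. g k) = g 1 + (\<Sum>i\<le>n. g (i + 2))" for g :: "nat \<Rightarrow> real"
proof -
  have "(\<Sum>k\<in>{1..n+2}. g k) = g 1 + (\<Sum>k\<in>{Suc 1..n+2}. g k)" by (rule sum.atLeast_Suc_atMost) simp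
  moreover have "Suc 1 = 2" by simp
  ultimately show ?thesis by (simp only: sum_shift_2)
qed

text \<open>The product topology on points has a countable basis, so a map into it is measurable as soon as its
  coordinates are.\<close>

lemma measurable_along_point:
  assumes g: "continuous_on (dom_f n a b) g"
    and y: "\<And>i. i \<le> n \<Longrightarrow> y i \<in> borel_measurable (lebesgue_on {a..b})"
  shows "(\<lambda>t. g (point n t (\<lambda>i. y i t))) \<in> borel_measurable (lebesgue_on {a..b})"
proof -
  have "(\<lambda>t. point n t (\<lambda>i. y i t) k) \<in> borel_measurable (lebesgue_on {a..b})" for k
  proof -
    consider "k = 1" | "k \<in> {2..n+2}" | "k \<notin> {1..n+2}" by fastforce
    then show ?thesis
    proof cases
      case 1
      have "(\<lambda>t::real. t) \<in> borel_measurable (lebesgue_on {a..b})"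
        by (rule measurable_restrict_space1) (auto intro: measurable_completion)
      then show ?thesis using 1 by (simp add: point_def)
    next
      case 2
      then show ?thesis using y[of "k - 2"] by (auto simp: point_def)
    qed (auto simp: point_def)
  qed
  then have "(\<lambda>t. point n t (\<lambda>i. y i t)) \<in> borel_measurable (lebesgue_on {a..b})"
    by (rule measurable_coordinatewise_then_product)
  then have "(\<lambda>t. point n t (\<lambda>i. y i t)) \<in> measurable (lebesgue_on {a..b}) (restrict_space borel (dom_f n a b))"
    by (rule measurable_restrict_space2[rotated]) (auto intro!: point_in_dom_f)
  from measurable_compose[OF this borel_measurable_continuous_on_restrict[OF g]] show ?thesis .
qed

text \<open>Dominated convergence for the difference quotients along a sequence tending to \<open>0\<close>; by the mean value
  theorem the bound \<open>w\<close> for the derivative also bounds the difference quotients.\<close>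

lemma DERIV_under_integral:
  fixes G G' :: "real \<Rightarrow> 'a \<Rightarrow> real"
  assumes int: "\<And>s. \<bar>s\<bar> \<le> 1 \<Longrightarrow> integrable M (G s)" and w: "integrable M w"
    and m: "G' 0 \<in> borel_measurable M"
    and der: "AE x in M. \<forall>s. \<bar>s\<bar> \<le> 1 \<longrightarrow> ((\<lambda>s. G s x) has_real_derivative G' s x) (at s) \<and> \<bar>G' s x\<bar> \<le> w x"
  shows "((\<lambda>s. LINT x|M. G s x) has_real_derivative (LINT x|M. G' 0 x)) (at 0)"
  unfolding has_field_derivative_iff tendsto_at_iff_sequentially
proof (intro allI impI)
  fix X :: "nat \<Rightarrow> real" assume X: "\<forall>i. X i \<in> UNIV - {0}" "X \<longlonglongrightarrow> 0"
  have "\<forall>\<^sub>F k in sequentially. \<bar>X k\<bar> < 1"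
    using order_tendstoD(2)[OF tendsto_rabs[OF X(2)], of 1] by simp
  then obtain N where N: "\<And>k. k \<ge> N \<Longrightarrow> \<bar>X k\<bar> < 1" by (auto simp: eventually_sequentially)
  define Z where "Z k = X (k + N)" for k
  have Z0: "Z k \<noteq> 0" and Z1: "\<bar>Z k\<bar> \<le> 1" for k using X(1) N[of "k + N"] by (auto simp: Z_def)
  have Zlim: "Z \<longlonglongrightarrow> 0" unfolding Z_def using X(2) by (rule LIMSEQ_ignore_initial_segment)
  have "(\<lambda>k. LINT x|M. (G (Z k) x - G 0 x) / Z k) \<longlonglongrightarrow> (LINT x|M. G' 0 x)"
  proof (rule integral_dominated_convergence[OF m _ w])
    show "(\<lambda>x. (G (Z k) x - G 0 x) / Z k) \<in> borel_measurable M" for k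
      using int[OF Z1[of k]] int[of 0] by auto
    show "AE x in M. (\<lambda>k. (G (Z k) x - G 0 x) / Z k) \<longlonglongrightarrow> G' 0 x"
      using der
    proof eventually_elim
      case (elim x)
      have "((\<lambda>h. (G h x - G 0 x) / (h - 0)) \<longlongrightarrow> G' 0 x) (at 0)"
        using elim[rule_format, of 0] by (simp add: has_field_derivative_iff)
      then have "((\<lambda>h. (G h x - G 0 x) / (h - 0)) \<circ> Z) \<longlonglongrightarrow> G' 0 x"
        unfolding tendsto_at_iff_sequentially using Z0 Zlim by auto
      then show ?case by (simp add: o_def)
    qed
    show "AE x in M. norm ((G (Z k) x - G 0 x) / Z k) \<le> w x" for k
      using der
    proof eventually_elim
      case (elim x)
      have "norm (G (Z k) x - G 0 x) \<le> w x * norm (Z k - 0)"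
        by (rule field_differentiable_bound[of "{-1..1}" "\<lambda>s. G s x" "\<lambda>s. G' s x"])
          (use elim Z1[of k] in \<open>auto intro: has_field_derivative_at_within simp: abs_le_iff\<close>)
      then show ?case using Z0[of k] by (simp add: field_simps)
    qed
  qed
  moreover have "(LINT x|M. (G (Z k) x - G 0 x) / Z k) = ((LINT x|M. G (Z k) x) - (LINT x|M. G 0 x)) / (Z k - 0)" for k
    using int[OF Z1[of k]] int[of 0] by simp
  ultimately have "(\<lambda>k. ((LINT x|M. G (Z k) x) - (LINT x|M. G 0 x)) / (Z k - 0)) \<longlonglongrightarrow> (LINT x|M. G' 0 x)"
    by (simp only:)
  then have "(\<lambda>k. ((LINT x|M. G (X (k + N)) x) - (LINT x|M. G 0 x)) / (X (k + N) - 0)) \<longlonglongrightarrow> (LINT x|M. G' 0 x)"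
    by (simp add: Z_def)
  from LIMSEQ_offset[OF this] show "((\<lambda>y. ((LINT x|M. G y x) - (LINT x|M. G 0 x)) / (y - 0)) \<circ> X) \<longlonglongrightarrow> (LINT x|M. G' 0 x)"
    by (simp add: o_def)
qed

lemma sderiv_in_L2:
  assumes ab: "a < b" and u: "u \<in> sobolev n a b" and i: "i \<le> n"
  shows "sderiv n a b i u \<in> L2 a b"
proof (cases "i < n")
  case True
  then show ?thesis using sderiv_AE(2)[OF ab u] by (intro continuous_in_L2) simp
next
  case False
  then show ?thesis using sobolev_weak_deriv[OF u i] by (simp add: sderiv_def has_L2_weak_deriv_def)
qed

text \<open>The quadratic growth of \<open>f\<close> makes the integrals finite, and the linear growth of its partial
  derivatives provides an integrable bound that is uniform in \<open>\<bar>s\<bar> \<le> 1\<close>, because \<open>\<phi>\<close> and its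
  derivatives are bounded.\<close>

lemma first_variation:
  fixes v :: "nat \<Rightarrow> real \<Rightarrow> real"
  assumes ab: "a < b" and f: "cont_second_partials (dom_f n a b) {1..n+2} f"
    and h: "h \<in> L2 a b" and c1: "c1 \<ge> 0"
    and g1: "AE t in lebesgue_on {a..b}. \<forall>x\<in>dom_f n a b. x 1 = t \<longrightarrow>
           \<bar>f x\<bar> \<le> h t + c1 * (\<Sum>k=2..n+2. (x k)\<^sup>2)"
    and g2: "AE t in lebesgue_on {a..b}. \<forall>x\<in>dom_f n a b. x 1 = t \<longrightarrow>
           (\<forall>i\<in>{2..n+2}. \<bar>pderivative (dom_f n a b) i f x\<bar> \<le> h t + c1 * (\<Sum>k=2..n+2. \<bar>x k\<bar>))"
    and v: "\<And>i. i \<le> n \<Longrightarrow> v i \<in> L2 a b" and tf: "test_fun a b \<phi>"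
  shows "((\<lambda>s. LINT t|lebesgue_on {a..b}. f (point n t (\<lambda>i. v i t + s * (deriv ^^ i) \<phi> t)))
      has_real_derivative (LINT t|lebesgue_on {a..b}.
        (\<Sum>i\<le>n. pderivative (dom_f n a b) (i + 2) f (point n t (\<lambda>i. v i t)) * (deriv ^^ i) \<phi> t))) (at 0)"
proof -
  let ?D = "dom_f n a b" and ?M = "lebesgue_on {a..b}"
  define p where "p i = (deriv ^^ i) \<phi>" for i
  have ptf: "test_fun a b (p i)" for i unfolding p_def by (rule test_fun_higher_deriv[OF tf ab])
  define y where "y s i t = v i t + s * p i t" for s i t
  have yL: "y s i \<in> L2 a b" if "i \<le> n" for s i
    unfolding y_def by (intro L2_add L2_scale v that test_fun_in_L2 ptf)
  have ym: "y s i \<in> borel_measurable ?M" if "i \<le> n" for s i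
    using L2_measurable[OF yL[OF that]] by (simp add: measurable_closed_interval_iff)
  have L1: "integrable ?M u" "integrable ?M (\<lambda>t. \<bar>u t\<bar>)" if "u \<in> L2 a b" for u
    using L2_integrable[OF that] by (simp_all add: integrable_closed_interval_iff)
  have sq: "integrable ?M (\<lambda>t. (u t)\<^sup>2)" if "u \<in> L2 a b" for u
    using L2_square_integrable[OF that] by (simp add: integrable_closed_interval_iff)
  have "\<exists>C. \<forall>x. \<bar>p i x\<bar> \<le> C" for i using test_fun_bounded[OF ptf ab, of i] by metis
  then obtain C0 where C0: "\<And>i x. \<bar>p i x\<bar> \<le> C0 i" by metis
  define C where "C = (\<Sum>i\<le>n. C0 i)"
  have C0n: "0 \<le> C0 i" for i using C0[of i 0] by linarith
  have C: "\<bar>p i x\<bar> \<le> C" if "i \<le> n" for i x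
    using C0[of i x] member_le_sum[of i "{..n}" C0] C0n that by (auto simp: C_def)
  have Cn: "0 \<le> C" using C0n by (simp add: C_def sum_nonneg)
  define G where "G s t = f (point n t (\<lambda>i. y s i t))" for s t
  define G' where "G' s t = (\<Sum>i\<le>n. pderivative ?D (i + 2) f (point n t (\<lambda>i. y s i t)) * p i t)" for s t
  \<comment> \<open>The growth bound for the partial derivatives at the perturbed function, for \<open>\<bar>s\<bar> \<le> 1\<close>.\<close>
  define q where "q t = h t + c1 * (\<Sum>i\<le>n. \<bar>v i t\<bar> + C)" for t
  have const: "integrable ?M (\<lambda>_. c)" for c :: real by (rule continuous_imp_integrable_real) simp
  have Gm: "G s \<in> borel_measurable ?M" for s
    unfolding G_def by (rule measurable_along_point[OF continuous_of_cont_second_partials[OF f] ym])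
  have Gi: "integrable ?M (G s)" for s
  proof (rule Bochner_Integration.integrable_bound[OF _ Gm])
    show "integrable ?M (\<lambda>t. h t + c1 * (\<Sum>i\<le>n. (y s i t)\<^sup>2))"
      using L1(1)[OF h] sq[OF yL] by (intro Bochner_Integration.integrable_add integrable_mult_right
          Bochner_Integration.integrable_sum) auto
    show "AE t in ?M. norm (G s t) \<le> norm (h t + c1 * (\<Sum>i\<le>n. (y s i t)\<^sup>2))"
      using g1 AE_space
    proof eventually_elim
      case (elim t)
      then have "\<bar>G s t\<bar> \<le> h t + c1 * (\<Sum>k=2..n+2. (point n t (\<lambda>i. y s i t) k)\<^sup>2)"
        unfolding G_def by (intro elim(1)[rule_format] point_in_dom_f point_apply(1)) simp
      also have "\<dots> = h t + c1 * (\<Sum>i\<le>n. (y s i t)\<^sup>2)"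
        unfolding sum_shift_2 by (simp add: point_apply(2) del: add_2_eq_Suc')
      finally show ?case by simp
    qed
  qed
  have "((\<lambda>s. LINT t|?M. G s t) has_real_derivative (LINT t|?M. G' 0 t)) (at 0)"
  proof (rule DERIV_under_integral[where w = "\<lambda>t. (\<Sum>i\<le>n. q t * C)"])
    show "integrable ?M (G s)" for s by (rule Gi)
    show "integrable ?M (\<lambda>t. \<Sum>i\<le>n. q t * C)"
      unfolding q_def using L1(1)[OF h] L1(2)[OF v] const
      by (intro Bochner_Integration.integrable_sum integrable_mult_left Bochner_Integration.integrable_add integrable_mult_right) auto
    show "G' 0 \<in> borel_measurable ?M"
      unfolding G'_def
    proof (intro borel_measurable_sum borel_measurable_times)
      fix i assume "i \<in> {..n}"
      then show "(\<lambda>t. pderivative ?D (i + 2) f (point n t (\<lambda>i. y 0 i t))) \<in> borel_measurable ?M"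
        by (intro measurable_along_point pderivative_continuous f ym) auto
      show "p i \<in> borel_measurable ?M" by (rule smooth_borel_on[OF test_fun_smooth[OF ptf]])
    qed
    show "AE t in ?M. \<forall>s. \<bar>s\<bar> \<le> 1 \<longrightarrow> ((\<lambda>s. G s t) has_real_derivative G' s t) (at s) \<and> \<bar>G' s t\<bar> \<le> (\<Sum>i\<le>n. q t * C)"
      using g2 AE_space
    proof eventually_elim
      case (elim t)
      then have t: "t \<in> {a..b}" by simp
      note inD = point_in_dom_f[OF t, of n]
      show ?case
      proof (intro allI impI conjI)
        fix s :: real assume s: "\<bar>s\<bar> \<le> 1"
        have "((\<lambda>s. f (point n t (\<lambda>i. y s i t))) has_real_derivative
            (\<Sum>k\<in>{1..n+2}. pderivative ?D k f (point n t (\<lambda>i. y s i t)) * (if k = 1 then 0 else p (k - 2) t))) (at s)"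
        proof (rule chain_rule_partials[OF coord_box_dom_f])
          show "pdifferentiable ?D k f x" if "k \<in> {1..n+2}" "x \<in> ?D" for k x
            using f that by (auto simp: cont_second_partials_def)
          show "((\<lambda>s. point n t (\<lambda>i. y s i t) k) has_real_derivative (if k = 1 then 0 else p (k - 2) t)) (at s)"
            if "k \<in> {1..n+2}" for k
            using that by (auto simp: point_def y_def intro!: derivative_eq_intros)
        qed (use inD pderivative_continuous[OF f] in auto)
        then show "((\<lambda>s. G s t) has_real_derivative G' s t) (at s)"
          unfolding G_def G'_def sum_shift_1 by simp
        have bd: "\<bar>pderivative ?D (i + 2) f (point n t (\<lambda>i. y s i t))\<bar> \<le> q t" if "i \<le> n" for i
        proof -
          have "\<bar>pderivative ?D (i + 2) f (point n t (\<lambda>i. y s i t))\<bar> \<le> h t + c1 * (\<Sum>k=2..n+2. \<bar>point n t (\<lambda>i. y s i t) k\<bar>)"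
            using elim(1)[rule_format, OF inD point_apply(1), of "i + 2"] that by simp
          also have "\<dots> = h t + c1 * (\<Sum>i\<le>n. \<bar>y s i t\<bar>)"
            unfolding sum_shift_2 by (simp add: point_apply(2) del: add_2_eq_Suc')
          also have "\<dots> \<le> q t"
            unfolding q_def
          proof (intro add_left_mono mult_left_mono sum_mono c1)
            fix j assume "j \<in> {..n}"
            then have "\<bar>s * p j t\<bar> \<le> 1 * C" unfolding abs_mult by (intro mult_mono s C) auto
            then show "\<bar>y s j t\<bar> \<le> \<bar>v j t\<bar> + C" by (simp add: y_def)
          qed
          finally show ?thesis .
        qed
        then have qn: "0 \<le> q t" using bd[of 0] by linarith
        have "\<bar>G' s t\<bar> \<le> (\<Sum>i\<le>n. \<bar>pderivative ?D (i + 2) f (point n t (\<lambda>i. y s i t)) * p i t\<bar>)"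
          unfolding G'_def by (rule sum_abs)
        also have "\<dots> \<le> (\<Sum>i\<le>n. q t * C)"
          unfolding abs_mult by (intro sum_mono mult_mono bd C qn) auto
        finally show "\<bar>G' s t\<bar> \<le> (\<Sum>i\<le>n. q t * C)" .
      qed
    qed
  qed
  then show ?thesis by (simp add: G_def G'_def y_def p_def)
qed

text \<open>The Sobolev norm of \<open>s \<phi>\<close> is proportional to \<open>\<bar>s\<bar>\<close>, so small perturbations compete with \<open>u0\<close> and the
  first variation vanishes at the extremum.\<close>

lemma weak_euler_lagrange:
  assumes ab: "a < b" and N: "N \<subseteq> {0..n}" "N' \<subseteq> {0..n}"
    and f: "cont_second_partials (dom_f n a b) {1..n+2} f"
    and h: "h \<in> L2 a b" and c1: "c1 \<ge> 0"
    and g1: "AE t in lebesgue_on {a..b}. \<forall>x\<in>dom_f n a b. x 1 = t \<longrightarrow>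
           \<bar>f x\<bar> \<le> h t + c1 * (\<Sum>k=2..n+2. (x k)\<^sup>2)"
    and g2: "AE t in lebesgue_on {a..b}. \<forall>x\<in>dom_f n a b. x 1 = t \<longrightarrow>
           (\<forall>i\<in>{2..n+2}. \<bar>pderivative (dom_f n a b) i f x\<bar> \<le> h t + c1 * (\<Sum>k=2..n+2. \<bar>x k\<bar>))"
    and u: "u0 \<in> admissible n a b N N' \<alpha> \<beta>"
    and ext: "local_extremum n a b (admissible n a b N N' \<alpha> \<beta>) (functional n a b f) u0"
    and tf: "test_fun a b \<phi>"
  shows "(LINT t|lebesgue_on {a..b}. (\<Sum>i\<le>n. pderivative (dom_f n a b) (i + 2) f
            (point n t (\<lambda>i. sderiv n a b i u0 t)) * (deriv ^^ i) \<phi> t)) = 0"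
proof -
  let ?M = "lebesgue_on {a..b}"
  have us: "u0 \<in> sobolev n a b" using u by (simp add: admissible_def)
  define \<Phi> where "\<Phi> s = (LINT t|?M. f (point n t (\<lambda>i. sderiv n a b i u0 t + s * (deriv ^^ i) \<phi> t)))" for s
  have fun_eq: "functional n a b f (\<lambda>x. u0 x + s * \<phi> x) = \<Phi> s" for s
    unfolding functional_def \<Phi>_def
  proof (rule integral_cong_AE)
    note fc = continuous_of_cont_second_partials[OF f]
    have m: "sderiv n a b i u \<in> borel_measurable ?M" if "u \<in> sobolev n a b" "i \<le> n" for u i
      using L2_measurable[OF sderiv_in_L2[OF ab that]] by (simp add: measurable_closed_interval_iff)
    show "(\<lambda>t. f (point n t (\<lambda>i. sderiv n a b i (\<lambda>x. u0 x + s * \<phi> x) t))) \<in> borel_measurable ?M"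
      by (intro measurable_along_point fc m sobolev_perturb ab us tf)
    show "(\<lambda>t. f (point n t (\<lambda>i. sderiv n a b i u0 t + s * (deriv ^^ i) \<phi> t))) \<in> borel_measurable ?M"
      by (intro measurable_along_point fc borel_measurable_add borel_measurable_times borel_measurable_const m us
          smooth_borel_on smooth_higher_deriv test_fun_smooth[OF tf])
    have "AE t in ?M. \<forall>i\<in>{..n}. sderiv n a b i (\<lambda>x. u0 x + s * \<phi> x) t = sderiv n a b i u0 t + s * (deriv ^^ i) \<phi> t"
      unfolding AE_closed_interval_iff
      by (rule AE_finite_allI) (auto intro: sderiv_perturb_AE[OF ab us tf])
    then show "AE t in ?M. f (point n t (\<lambda>i. sderiv n a b i (\<lambda>x. u0 x + s * \<phi> x) t)) =
        f (point n t (\<lambda>i. sderiv n a b i u0 t + s * (deriv ^^ i) \<phi> t))"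
      by eventually_elim (auto intro!: arg_cong[of _ _ f] point_cong)
  qed
  have F0: "functional n a b f u0 = \<Phi> 0" using fun_eq[of 0] by simp
  define C where "C = (\<Sum>i=0..n. L2_norm a b ((deriv ^^ i) \<phi>))"
  have Cn: "0 \<le> C" unfolding C_def by (intro sum_nonneg) (auto simp: L2_norm_def)
  obtain \<epsilon> where \<epsilon>: "\<epsilon> > 0" and ex:
    "(\<forall>u\<in>admissible n a b N N' \<alpha> \<beta>. sobolev_norm n a b (\<lambda>x. u x - u0 x) < \<epsilon> \<longrightarrow> functional n a b f u \<ge> functional n a b f u0) \<or>
     (\<forall>u\<in>admissible n a b N N' \<alpha> \<beta>. sobolev_norm n a b (\<lambda>x. u x - u0 x) < \<epsilon> \<longrightarrow> functional n a b f u \<le> functional n a b f u0)"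
    using ext unfolding local_extremum_def by blast
  \<comment> \<open>\<open>C\<close> may be zero, hence the added \<open>1\<close>.\<close>
  define \<delta> where "\<delta> = \<epsilon> / (C + 1)"
  have \<delta>: "\<delta> > 0" using \<epsilon> Cn by (simp add: \<delta>_def)
  have near: "sobolev_norm n a b (\<lambda>x. (u0 x + s * \<phi> x) - u0 x) < \<epsilon>" if s: "\<bar>s\<bar> < \<delta>" for s
  proof -
    have "sobolev_norm n a b (\<lambda>x. (u0 x + s * \<phi> x) - u0 x) = \<bar>s\<bar> * C"
      using sobolev_norm_test_fun[OF ab tf, of n s] by (simp add: C_def)
    also have "\<dots> \<le> \<bar>s\<bar> * (C + 1)" by (intro mult_left_mono) auto
    also have "\<dots> < \<epsilon>" using s Cn by (simp add: \<delta>_def pos_less_divide_eq)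
    finally show ?thesis .
  qed
  note adm = admissible_perturb[OF ab N tf u]
  have "(\<forall>s. \<bar>0 - s\<bar> < \<delta> \<longrightarrow> \<Phi> 0 \<le> \<Phi> s) \<or> (\<forall>s. \<bar>0 - s\<bar> < \<delta> \<longrightarrow> \<Phi> s \<le> \<Phi> 0)"
    using ex
  proof (elim disj_forward)
    assume *: "\<forall>u\<in>admissible n a b N N' \<alpha> \<beta>. sobolev_norm n a b (\<lambda>x. u x - u0 x) < \<epsilon> \<longrightarrow> functional n a b f u \<ge> functional n a b f u0"
    show "\<forall>s. \<bar>0 - s\<bar> < \<delta> \<longrightarrow> \<Phi> 0 \<le> \<Phi> s"
      using *[rule_format, OF adm near] by (simp add: fun_eq F0)
  next
    assume *: "\<forall>u\<in>admissible n a b N N' \<alpha> \<beta>. sobolev_norm n a b (\<lambda>x. u x - u0 x) < \<epsilon> \<longrightarrow> functional n a b f u \<le> functional n a b f u0"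
    show "\<forall>s. \<bar>0 - s\<bar> < \<delta> \<longrightarrow> \<Phi> s \<le> \<Phi> 0"
      using *[rule_format, OF adm near] by (simp add: fun_eq F0)
  qed
  moreover have "(\<Phi> has_real_derivative (LINT t|?M. (\<Sum>i\<le>n. pderivative (dom_f n a b) (i + 2) f
            (point n t (\<lambda>i. sderiv n a b i u0 t)) * (deriv ^^ i) \<phi> t))) (at 0)"
    unfolding \<Phi>_def
    by (rule first_variation[OF ab f h c1 g1 g2 sderiv_in_L2[OF ab us] tf])
  ultimately show ?thesis
    using DERIV_local_min[OF _ \<delta>] DERIV_local_max[OF _ \<delta>] by blast
qed

section \<open>Regularity of the extremal\<close>

lemma continuous_along_point:
  assumes g: "continuous_on (dom_f n a b) g"
    and y: "\<And>i. i \<le> n \<Longrightarrow> continuous_on {a..b} (y i)"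
  shows "continuous_on {a..b} (\<lambda>t. g (point n t (\<lambda>i. y i t)))"
proof -
  have "continuous_on {a..b} (\<lambda>t. point n t (\<lambda>i. y i t) k)" for k
  proof -
    consider "k = 1" | "k \<in> {2..n+2}" | "k \<notin> {1..n+2}" by fastforce
    then show ?thesis
    proof cases
      case 2
      then show ?thesis using y[of "k - 2"] by (auto simp: point_def)
    qed (auto simp: point_def)
  qed
  then have "continuous_on {a..b} (\<lambda>t. point n t (\<lambda>i. y i t))"
    by (rule continuous_on_coordinatewise_then_product)
  then show ?thesis
    by (rule continuous_on_compose2[OF g]) (auto intro!: point_in_dom_f)
qed

text \<open>If \<open>s < w t0\<close> then \<open>Q t0 s < E t0\<close>. This strict inequality persists for \<open>t\<close> near \<open>t0\<close>, where by
  monotonicity it means \<open>s < w t\<close>; upper bounds are symmetric.\<close>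

lemma continuous_implicit_function:
  fixes Q :: "real \<Rightarrow> real \<Rightarrow> real"
  assumes Q: "\<And>s. continuous_on S (\<lambda>t. Q t s)" and E: "continuous_on S E"
    and mono: "\<And>t. t \<in> S \<Longrightarrow> strict_mono (Q t)" and w: "\<And>t. t \<in> S \<Longrightarrow> Q t (w t) = E t"
  shows "continuous_on S w"
  unfolding continuous_on_def
proof
  fix t0 assume t0: "t0 \<in> S"
  have inS: "\<forall>\<^sub>F t in at t0 within S. t \<in> S" by (simp add: eventually_at_filter)
  have lim: "((\<lambda>t. Q t s - E t) \<longlongrightarrow> Q t0 s - E t0) (at t0 within S)" for s
    using Q[of s] E t0 by (intro tendsto_diff) (auto simp: continuous_on_def)
  show "(w \<longlongrightarrow> w t0) (at t0 within S)"
  proof (rule order_tendstoI)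
    fix s assume "s < w t0"
    then have "Q t0 s - E t0 < 0" using mono[OF t0] w[OF t0] by (metis diff_less_0_iff_less strict_monoD)
    from order_tendstoD(2)[OF lim this] inS show "\<forall>\<^sub>F t in at t0 within S. s < w t"
    proof eventually_elim
      case (elim t)
      then have "Q t s < Q t (w t)" using w by simp
      then show ?case using mono elim(2) strict_mono_less by blast
    qed
  next
    fix s assume "w t0 < s"
    then have "0 < Q t0 s - E t0" using mono[OF t0] w[OF t0] by (metis diff_gt_0_iff_gt strict_monoD)
    from order_tendstoD(1)[OF lim this] inS show "\<forall>\<^sub>F t in at t0 within S. w t < s"
    proof eventually_elim
      case (elim t)
      then have "Q t (w t) < Q t s" using w by simp
      then show ?case using mono elim(2) strict_mono_less by blast
    qed
  qed
qed

lemma indefinite_integral_DERIV: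
  fixes g :: "real \<Rightarrow> real"
  assumes c: "continuous_on {a..b} g" and t: "t \<in> {a..b}"
    and F: "\<And>t. t \<in> {a..b} \<Longrightarrow> F t = K + integral {a..t} g"
  shows "(F has_real_derivative g t) (at t within {a..b})"
proof -
  have "((\<lambda>t. K + integral {a..t} g) has_real_derivative g t) (at t within {a..b})"
    using integral_has_vector_derivative[OF c t]
    by (auto intro!: derivative_eq_intros simp: has_real_derivative_iff_has_vector_derivative)
  then show ?thesis
    by (rule has_field_derivative_transform_within[of _ _ _ _ 1]) (use t F in auto)
qed

lemma psi_has_derivative:
  assumes f: "cont_second_partials (dom_f n a b) {1..n+2} f" and t: "t \<in> {a..b}"
  shows "(psi n a b f u t has_real_derivative
     pderivative (dom_f n a b) (n + 2) (pderivative (dom_f n a b) (n + 2) f)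
       (point n t (\<lambda>i. if i < n then sderiv n a b i u t else s))) (at s)"
proof -
  let ?D = "dom_f n a b"
  define x where "x s = point n t (\<lambda>i. if i < n then sderiv n a b i u t else s)" for s
  have xD: "x s \<in> ?D" for s unfolding x_def by (rule point_in_dom_f[OF t])
  have upd: "(x s)(n + 2 := r) = x r" for r by (auto simp: x_def point_def fun_eq_iff)
  have "pdifferentiable ?D (n + 2) (pderivative ?D (n + 2) f) (x s)"
    using f xD by (simp add: cont_second_partials_def)
  from pderivative_works[OF this] have "((\<lambda>r. pderivative ?D (n + 2) f (x r)) has_vector_derivative
      pderivative ?D (n + 2) (pderivative ?D (n + 2) f) (x s)) (at s within {r. x r \<in> ?D})"
    unfolding upd by (simp add: x_def point_def)
  moreover have "{r. x r \<in> ?D} = UNIV" using xD by auto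
  moreover have "psi n a b f u t = (\<lambda>r. pderivative ?D (n + 2) f (x r))"
    by (simp add: fun_eq_iff psi_def x_def)
  ultimately show ?thesis
    by (simp add: has_real_derivative_iff_has_vector_derivative x_def)
qed

lemma partials_integrable:
  assumes f: "cont_second_partials (dom_f n a b) {1..n+2} f"
    and h: "h \<in> L2 a b"
    and g2: "AE t in lebesgue_on {a..b}. \<forall>x\<in>dom_f n a b. x 1 = t \<longrightarrow>
           (\<forall>i\<in>{2..n+2}. \<bar>pderivative (dom_f n a b) i f x\<bar> \<le> h t + c1 * (\<Sum>k=2..n+2. \<bar>x k\<bar>))"
    and v: "\<And>i. i \<le> n \<Longrightarrow> v i \<in> L2 a b" and i: "i \<le> n"
  shows "integrable (lebesgue_on {a<..<b}) (\<lambda>t. pderivative (dom_f n a b) (i + 2) f (point n t (\<lambda>i. v i t)))"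
proof -
  let ?M = "lebesgue_on {a..b}"
  have "integrable ?M (\<lambda>t. pderivative (dom_f n a b) (i + 2) f (point n t (\<lambda>i. v i t)))"
  proof (rule Bochner_Integration.integrable_bound)
    show "integrable ?M (\<lambda>t. h t + c1 * (\<Sum>i\<le>n. \<bar>v i t\<bar>))"
      unfolding integrable_closed_interval_iff
      by (intro Bochner_Integration.integrable_add integrable_mult_right
          Bochner_Integration.integrable_sum integrable_abs L2_integrable h v) auto
    show "(\<lambda>t. pderivative (dom_f n a b) (i + 2) f (point n t (\<lambda>i. v i t))) \<in> borel_measurable ?M"
      using i by (intro measurable_along_point pderivative_continuous f)
        (auto simp: measurable_closed_interval_iff intro: L2_measurable v)
    show "AE t in ?M. norm (pderivative (dom_f n a b) (i + 2) f (point n t (\<lambda>i. v i t))) \<le> norm (h t + c1 * (\<Sum>i\<le>n. \<bar>v i t\<bar>))"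
      using g2 AE_space
    proof eventually_elim
      case (elim t)
      then have "\<bar>pderivative (dom_f n a b) (i + 2) f (point n t (\<lambda>i. v i t))\<bar> \<le> h t + c1 * (\<Sum>k=2..n+2. \<bar>point n t (\<lambda>i. v i t) k\<bar>)"
        by (intro elim(1)[rule_format] point_in_dom_f point_apply(1)) (use i in auto)
      also have "\<dots> = h t + c1 * (\<Sum>i\<le>n. \<bar>v i t\<bar>)"
        unfolding sum_shift_2 by (simp add: point_apply(2) del: add_2_eq_Suc')
      finally show ?case by simp
    qed
  qed
  then show ?thesis by (simp only: integrable_closed_interval_iff)
qed

text \<open>The increment of \<open>g\<close> along the curve is the increment of \<open>E\<close>. By \<open>increment_limit\<close> it is also a
  linear form in the increments of the coordinates, in which the one of \<open>G n\<close> has a coefficient with a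
  nonzero limit. Solving for it shows that its difference quotient converges. Of \<open>G n\<close> only continuity
  is assumed.\<close>

lemma implicit_derivative:
  fixes G :: "nat \<Rightarrow> real \<Rightarrow> real"
  assumes diff: "\<And>k x. k \<in> {1..n+2} \<Longrightarrow> x \<in> dom_f n a b \<Longrightarrow> pdifferentiable (dom_f n a b) k g x"
    and cont: "\<And>k. k \<in> {1..n+2} \<Longrightarrow> continuous_on (dom_f n a b) (pderivative (dom_f n a b) k g)"
    and t0: "t0 \<in> {a..b}"
    and E: "\<And>t. t \<in> {a..b} \<Longrightarrow> g (point n t (\<lambda>i. G i t)) = E t" "(E has_real_derivative E') (at t0 within {a..b})"
    and G: "\<And>i. i < n \<Longrightarrow> (G i has_real_derivative G' i) (at t0 within {a..b})"
    and Gn: "continuous_on {a..b} (G n)"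
    and nz: "pderivative (dom_f n a b) (n + 2) g (point n t0 (\<lambda>i. G i t0)) \<noteq> 0"
  shows "(G n has_real_derivative
      (E' - pderivative (dom_f n a b) 1 g (point n t0 (\<lambda>i. G i t0))
          - (\<Sum>i<n. pderivative (dom_f n a b) (i + 2) g (point n t0 (\<lambda>i. G i t0)) * G' i))
      / pderivative (dom_f n a b) (n + 2) g (point n t0 (\<lambda>i. G i t0))) (at t0 within {a..b})"
proof -
  let ?D = "dom_f n a b" and ?F = "at t0 within {a..b}"
  define Y where "Y t = point n t (\<lambda>i. G i t)" for t
  have YD: "Y t \<in> ?D" if "t \<in> {a..b}" for t unfolding Y_def by (rule point_in_dom_f[OF that])
  have inS: "\<forall>\<^sub>F t in ?F. t \<in> {a..b} \<and> t \<noteq> t0" by (simp add: eventually_at_filter)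
  have evD: "\<forall>\<^sub>F t in ?F. Y t \<in> ?D" using inS by eventually_elim (simp add: YD)
  have Glim: "(G i \<longlongrightarrow> G i t0) ?F" if "i \<le> n" for i
  proof (cases "i < n")
    case True
    then show ?thesis using DERIV_continuous[OF G[OF True]] by (simp add: continuous_within)
  next
    case False
    then show ?thesis using Gn t0 that by (auto simp: continuous_on_def)
  qed
  have Ylim: "((\<lambda>t. Y t j) \<longlongrightarrow> Y t0 j) ?F" for j
    using Glim[of "j - 2"] by (auto simp: Y_def point_def intro!: tendsto_intros)
  obtain P where P: "\<And>t. Y t \<in> ?D \<Longrightarrow> g (Y t) - g (Y t0) = (\<Sum>k\<in>{1..n+2}. P k t * (Y t k - Y t0 k))"
    "\<And>k. k \<in> {1..n+2} \<Longrightarrow> (P k \<longlongrightarrow> pderivative ?D k g (Y t0)) ?F"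
    using increment_limit[OF coord_box_dom_f diff cont YD[OF t0] evD Ylim] by blast
  have nz': "\<forall>\<^sub>F t in ?F. P (n + 2) t \<noteq> 0"
    by (rule tendsto_imp_eventually_ne[OF P(2)]) (use nz in \<open>auto simp: Y_def\<close>)
  have "((\<lambda>t. ((E t - E t0) / (t - t0) - P 1 t - (\<Sum>i<n. P (i + 2) t * ((G i t - G i t0) / (t - t0)))) / P (n + 2) t)
     \<longlongrightarrow> (E' - pderivative ?D 1 g (Y t0) - (\<Sum>i<n. pderivative ?D (i + 2) g (Y t0) * G' i)) / pderivative ?D (n + 2) g (Y t0)) ?F"
    by (intro tendsto_intros P(2)) (use E(2) G nz in \<open>auto simp: has_field_derivative_iff Y_def\<close>)
  moreover have "\<forall>\<^sub>F t in ?F. ((E t - E t0) / (t - t0) - P 1 t - (\<Sum>i<n. P (i + 2) t * ((G i t - G i t0) / (t - t0)))) / P (n + 2) t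
      = (G n t - G n t0) / (t - t0)"
    using inS evD nz'
  proof eventually_elim
    case (elim t)
    have "E t - E t0 = (\<Sum>k\<in>{1..n+2}. P k t * (Y t k - Y t0 k))"
      using P(1)[OF elim(2)] E(1)[of t] E(1)[OF t0] elim by (simp add: Y_def)
    also have "\<dots> = P 1 t * (t - t0) + (\<Sum>i\<le>n. P (i + 2) t * (G i t - G i t0))"
      unfolding sum_shift_1 by (simp add: Y_def point_apply del: add_2_eq_Suc' One_nat_def)
    also have "(\<Sum>i\<le>n. P (i + 2) t * (G i t - G i t0)) = (\<Sum>i<n. P (i + 2) t * (G i t - G i t0)) + P (n + 2) t * (G n t - G n t0)"
      unfolding lessThan_Suc_atMost[symmetric] by simp
    finally have "(E t - E t0) / (t - t0) = P 1 t + (\<Sum>i<n. P (i + 2) t * (G i t - G i t0)) / (t - t0) + P (n + 2) t * ((G n t - G n t0) / (t - t0))"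
      using elim(1) by (simp add: add_divide_distrib)
    then show ?case using elim(3) by (simp add: sum_divide_distrib)
  qed
  ultimately show ?thesis
    unfolding has_field_derivative_iff Y_def by (rule Lim_transform_eventually)
qed

text \<open>The weak derivative of order zero is a choice of representative and equals \<open>u\<close> only almost
  everywhere; the continuous representatives nevertheless coincide.\<close>

lemma cont_rep_eq_sderiv_0:
  assumes ab: "a < b" and u: "u \<in> sobolev n a b" and n: "n \<ge> 1" and t: "t \<in> {a..b}"
  shows "cont_rep a b u t = sderiv n a b 0 u t"
proof -
  have w: "has_L2_weak_deriv a b 0 u (weak_deriv a b 0 u)" by (rule sobolev_weak_deriv[OF u]) simp
  then have "has_L2_weak_deriv a b 0 u u" by (simp add: has_L2_weak_deriv_def)
  from weak_deriv_unique[OF ab w this]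
  have "AE x in lebesgue_on {a<..<b}. sderiv n a b 0 u x = u x"
    using sderiv_AE(1)[OF ab u le0] by eventually_elim auto
  from cont_rep_eq(3)[OF ab _ this t] show ?thesis using sderiv_AE(2)[OF ab u, of 0] n by simp
qed

theorem theorem3p4:
  fixes n :: nat and a b c1 :: real
    and N N' :: "nat set" and \<alpha> \<beta> :: "nat \<Rightarrow> real"
    and f :: "(nat \<Rightarrow> real) \<Rightarrow> real" and h u0 :: "real \<Rightarrow> real"
  assumes "n \<ge> 1" and "a < b"
    and "N \<subseteq> {0..n}" and "N' \<subseteq> {0..n}"
    and "cont_second_partials (dom_f n a b) {1..n+2} f"
    and "h \<in> L2 a b" and "c1 \<ge> 0"
    and "AE t in lebesgue_on {a..b}. \<forall>x\<in>dom_f n a b. x 1 = t \<longrightarrow>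
           \<bar>f x\<bar> \<le> h t + c1 * (\<Sum>k=2..n+2. (x k)\<^sup>2)"
    and "AE t in lebesgue_on {a..b}. \<forall>x\<in>dom_f n a b. x 1 = t \<longrightarrow>
           (\<forall>i\<in>{2..n+2}. \<bar>pderivative (dom_f n a b) i f x\<bar> \<le> h t + c1 * (\<Sum>k=2..n+2. \<bar>x k\<bar>))"
    and "u0 \<in> admissible n a b N N' \<alpha> \<beta>"
    and "local_extremum n a b (admissible n a b N N' \<alpha> \<beta>) (functional n a b f) u0"
    and "\<forall>t\<in>{a..b}. \<forall>s. deriv (psi n a b f u0 t) s > 0"
    and "\<forall>t\<in>{a..b}. surj (psi n a b f u0 t)"
  shows "Ck_on (n + 1) {a..b} (cont_rep a b u0)"
proof -
  note n = assms(1) and ab = assms(2) and f = assms(5) and h = assms(6)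
  let ?D = "dom_f n a b" and ?M = "lebesgue_on {a<..<b}"
  have us: "u0 \<in> sobolev n a b" using assms(10) by (simp add: admissible_def)
  define g where "g i = sderiv n a b i u0" for i
  define p where "p i = pderivative ?D (i + 2) f" for i
  define A where "A i t = p i (point n t (\<lambda>i. g i t))" for i t
  have pc: "continuous_on ?D (p i)" if "i \<le> n" for i
    unfolding p_def using that by (intro pderivative_continuous[OF f]) auto
  have gL2: "g i \<in> L2 a b" if "i \<le> n" for i unfolding g_def by (rule sderiv_in_L2[OF ab us that])
  have gc: "continuous_on {a..b} (g i)" if "i < n" for i
    unfolding g_def using sderiv_AE(2)[OF ab us _ that] that by simp
  have Ai: "integrable ?M (A i)" if "i \<le> n" for i
    unfolding A_def p_def by (rule partials_integrable[OF f h assms(9) gL2 that])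
  have "\<exists>E. E 0 = (\<lambda>_. 0) \<and> (\<forall>j<n. \<exists>K. \<forall>t. E (Suc j) t = K + integral {a..t} (\<lambda>s. A j s - E j s)) \<and>
           (AE x in ?M. A n x = E n x)"
  proof (rule du_bois_reymond_chain[OF ab _ Ai])
    fix \<phi> assume tf: "test_fun a b \<phi>"
    have "(\<Sum>i\<le>n. A i t * (deriv ^^ i) \<phi> t) = (A 0 t - 0) * \<phi> t + (\<Sum>i<n. A (Suc i) t * (deriv ^^ Suc i) \<phi> t)" for t
      unfolding lessThan_Suc_atMost[symmetric] sum.lessThan_Suc_shift by simp
    moreover have "(LINT t|?M. (\<Sum>i\<le>n. A i t * (deriv ^^ i) \<phi> t)) = 0"
      using weak_euler_lagrange[OF ab assms(3,4) f h assms(7,8,9,10,11) tf]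
      unfolding integrable_closed_interval_iff(2) A_def p_def g_def .
    ultimately show "(LINT t|?M. (A 0 t - 0) * \<phi> t + (\<Sum>i<n. A (Suc i) t * (deriv ^^ Suc i) \<phi> t)) = 0"
      by (simp only:)
  qed auto
  then obtain E where E0: "E 0 = (\<lambda>_. 0)" and AE_E: "AE t in ?M. A n t = E n t"
    and E_Suc: "\<And>j. j < n \<Longrightarrow> \<exists>K. \<forall>t. E (Suc j) t = K + integral {a..t} (\<lambda>s. A j s - E j s)" by blast
  have Ec: "continuous_on {a..b} (E j)" if "j \<le> n" for j
    using that
  proof (induction j)
    case 0
    then show ?case by (simp add: E0)
  next
    case (Suc j)
    then obtain K where K: "E (Suc j) = (\<lambda>t. K + integral {a..t} (\<lambda>s. A j s - E j s))"
      using E_Suc[of j] by auto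
    have "integrable ?M (\<lambda>s. A j s - E j s)"
      using Suc Ai[of j] continuous_imp_integrable_open[of a b "E j"] by simp
    then show ?case unfolding K by (intro continuous_intros indefinite_integral_continuous)
  qed
  define q where "q = psi n a b f u0"
  define P where "P k = pderivative ?D k (pderivative ?D (n + 2) f)" for k
  have q_eq: "q t s = p n (point n t (\<lambda>i. if i < n then g i t else s))" for t s
    unfolding q_def psi_def p_def g_def ..
  have q_der: "(q t has_real_derivative P (n + 2) (point n t (\<lambda>i. if i < n then g i t else s))) (at s)"
    if "t \<in> {a..b}" for t s
    unfolding q_def P_def g_def by (rule psi_has_derivative[OF f that])
  have P_pos: "P (n + 2) (point n t (\<lambda>i. if i < n then g i t else s)) > 0" if t: "t \<in> {a..b}" for t s
    using bspec[OF assms(12) t, THEN spec, of s] DERIV_imp_deriv[OF q_der[OF t, of s]] by (simp add: q_def)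
  \<comment> \<open>The highest derivative is recovered by inverting \<open>q t\<close>, first as a continuous function.\<close>
  have q_mono: "strict_mono (q t)" if t: "t \<in> {a..b}" for t
    by (rule strict_monoI, rule DERIV_pos_imp_increasing) (use q_der[OF t] P_pos[OF t] in blast)+
  have "\<forall>t. \<exists>s. t \<in> {a..b} \<longrightarrow> q t s = E n t"
    using assms(13) unfolding q_def by (metis surjD)
  then obtain w where w: "\<And>t. t \<in> {a..b} \<Longrightarrow> q t (w t) = E n t" by metis
  have wc: "continuous_on {a..b} w"
  proof (rule continuous_implicit_function[where Q = q, OF _ Ec[OF order_refl] q_mono w])
    show "continuous_on {a..b} (\<lambda>t. q t s)" for s
      unfolding q_eq
    proof (rule continuous_along_point[where y = "\<lambda>i t. if i < n then g i t else s", OF pc[OF order_refl]])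
      show "continuous_on {a..b} (\<lambda>t. if i < n then g i t else s)" for i
        by (cases "i < n") (simp_all add: gc)
    qed
  qed
  have AE_w: "AE t in ?M. g n t = w t"
    using AE_E AE_space
  proof eventually_elim
    case (elim t)
    then have t: "t \<in> {a..b}" by simp
    have "A n t = q t (g n t)"
      unfolding A_def q_eq by (intro arg_cong[of _ _ "p n"] point_cong) (auto simp: le_less)
    then have "q t (g n t) = q t (w t)" using elim w[OF t] by simp
    then show ?case using q_mono[OF t] by (simp add: strict_mono_eq)
  qed
  \<comment> \<open>The derivatives of \<open>u0\<close> up to order \<open>n\<close>, now all continuous; \<open>B\<close> below is \<open>A\<close> evaluated along
    them.\<close>
  define G where "G i = (if i < n then g i else w)" for i
  have Gc: "continuous_on {a..b} (G i)" for i using gc wc by (simp add: G_def)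
  have AE_G: "AE t in ?M. \<forall>i\<in>{..n}. g i t = G i t"
    using AE_w by eventually_elim (auto simp: G_def le_less)
  have Gder: "(G i has_real_derivative G (Suc i) t) (at t within {a..b})" if i: "i < n" and t: "t \<in> {a..b}" for i t
  proof -
    obtain K where K: "\<And>t. t \<in> {a..b} \<Longrightarrow> g i t = K + integral {a..t} (g (Suc i))"
      unfolding g_def using sderiv_primitive[OF ab us i] by blast
    have "AE t in ?M. g (Suc i) t = G (Suc i) t" using AE_G i by (auto elim: eventually_mono)
    then have "G i t = K + integral {a..t} (G (Suc i))" if "t \<in> {a..b}" for t
      using K[OF that] integral_cong_AE_interval[where f = "g (Suc i)" and g = "G (Suc i)" and a = a and b = b and t = t] that i by (simp add: G_def)
    then show ?thesis by (rule indefinite_integral_DERIV[OF Gc t])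
  qed
  define Y where "Y t = point n t (\<lambda>i. G i t)" for t
  define B where "B i t = p i (Y t)" for i t
  have Bc: "continuous_on {a..b} (B i)" if "i \<le> n" for i
    unfolding B_def Y_def by (rule continuous_along_point[OF pc[OF that] Gc])
  have AE_B: "AE t in ?M. A i t = B i t" for i
    using AE_G by eventually_elim (auto simp: A_def B_def Y_def intro!: arg_cong[of _ _ "p i"] point_cong)
  obtain m where m: "n = Suc m" using n by (cases n) auto
  \<comment> \<open>With a continuous integrand the last step of the chain gives a classical derivative.\<close>
  define E' where "E' t = B m t - E m t" for t
  have E'c: "continuous_on {a..b} E'" unfolding E'_def using Bc[of m] Ec[of m] m by (intro continuous_intros) auto
  have Eder: "(E n has_real_derivative E' t) (at t within {a..b})" if t: "t \<in> {a..b}" for t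
  proof -
    obtain K where K: "\<And>t. E n t = K + integral {a..t} (\<lambda>s. A m s - E m s)" using E_Suc[of m] m by auto
    have "AE t in ?M. A m t - E m t = E' t" using AE_B[of m] by eventually_elim (simp add: E'_def)
    then have "E n t = K + integral {a..t} E'" if "t \<in> {a..b}" for t
      using K integral_cong_AE_interval[where f = "\<lambda>s. A m s - E m s" and g = E' and a = a and b = b and t = t] that by simp
    then show ?thesis by (rule indefinite_integral_DERIV[OF E'c t])
  qed
  have Y_eq: "Y t = point n t (\<lambda>i. if i < n then g i t else w t)" for t by (simp add: Y_def G_def if_distrib[of "\<lambda>x. x t"])
  have P_nz: "P (n + 2) (Y t) \<noteq> 0" if "t \<in> {a..b}" for t using P_pos[OF that, of "w t"] by (simp add: Y_eq)
  \<comment> \<open>Implicit differentiation of \<open>q t (w t) = E n t\<close>.\<close>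
  define w' where "w' t = (E' t - P 1 (Y t) - (\<Sum>i<n. P (i + 2) (Y t) * G (Suc i) t)) / P (n + 2) (Y t)" for t
  have Pc: "continuous_on {a..b} (\<lambda>t. P k (Y t))" if "k \<in> {1..n+2}" for k
    unfolding Y_def
  proof (rule continuous_along_point[OF _ Gc])
    show "continuous_on ?D (P k)" using f that by (simp add: cont_second_partials_def P_def)
  qed
  have w'c: "continuous_on {a..b} w'"
    unfolding w'_def using P_nz by (intro continuous_intros E'c Gc Pc) auto
  have wder: "(w has_real_derivative w' t) (at t within {a..b})" if t: "t \<in> {a..b}" for t
  proof -
    have "(G n has_real_derivative w' t) (at t within {a..b})"
      unfolding w'_def P_def Y_def
    proof (rule implicit_derivative[OF _ _ t _ Eder[OF t] Gder[OF _ t] Gc])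
      show "pdifferentiable ?D k (pderivative ?D (n + 2) f) x" if "k \<in> {1..n+2}" "x \<in> ?D" for k x
        using f that by (simp add: cont_second_partials_def)
      show "continuous_on ?D (pderivative ?D k (pderivative ?D (n + 2) f))" if "k \<in> {1..n+2}" for k
        using f that by (simp add: cont_second_partials_def)
      show "pderivative ?D (n + 2) f (point n t (\<lambda>i. G i t)) = E n t" if "t \<in> {a..b}" for t
        using w[OF that] q_eq[of t "w t"] Y_eq[of t] by (simp add: p_def Y_def)
      show "pderivative ?D (n + 2) (pderivative ?D (n + 2) f) (point n t (\<lambda>i. G i t)) \<noteq> 0"
        using P_nz[OF t] by (simp add: P_def Y_def)
    qed
    then show ?thesis by (simp add: G_def)
  qed
  show ?thesis
    unfolding Ck_on_def
  proof (intro exI[of _ "\<lambda>i. if i \<le> n then G i else w'"] conjI ballI allI impI)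
    show "(if 0 \<le> n then G 0 else w') x = cont_rep a b u0 x" if "x \<in> {a..b}" for x
      using cont_rep_eq_sderiv_0[OF ab us n that] n by (simp add: G_def g_def)
    show "((if i \<le> n then G i else w') has_real_derivative (if Suc i \<le> n then G (Suc i) else w') x) (at x within {a..b})"
      if "i < n + 1" "x \<in> {a..b}" for i x
      using Gder[of i x] wder[of x] that by (cases "i < n") (auto simp: G_def)
    show "continuous_on {a..b} (if i \<le> n then G i else w')" for i
      using Gc w'c by simp
  qed
qed

end
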